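(* Let $\mathcal{M}_m$ be a meridian surface in $\mathbb{E}^4_2$ parametrized by $$z(u,v) = f(u)\left(\varphi(v)\cosh v\, e_1 + \varphi(v)\sinh v\, e_3 + \frac{\varphi^2(v)}{2}\,\xi_1 + \xi_2\right) + g(u)\,\xi_1,\quad u\in I,\ v\in J,$$ with the normalization $2\varepsilon f'g'=1$ on $I$, and suppose that the curvature $\kappa$ of the curve $c$ is not identically zero. Then $\mathcal{M}_m$ has parallel normalized mean curvature vector field but not parallel mean curvature vector if and only if one of the following cases holds: (i) $\kappa\neq0$ (i.e. $\kappa(v)\ne 0$ for all $v\in J$) and the meridian curve $m$ is defined by $$f(u)=\sqrt{au+b},\qquad g(u)=\frac{2\varepsilon}{3a^2}(au+b)^{3/2}+c,$$ where $a=\mathrm{const}\neq0$, $b=\mathrm{const}$, $c=\mathrm{const}$. (ii) $\kappa=\mathrm{const}\neq0$ and the meridian curve $m$ is determined by $f'=\phi(f)$, where $$\phi(t)=\frac{c\,t+b}{t},\qquad c=\mathrm{const}\neq0,\quad c^2\neq\kappa^2,\quad b=\mathrm{const},$$ and $g(u)$ is defined by $g'(u)=\frac{\varepsilon}{2f'(u)}$.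
   Context: $\mathbb{E}^4_2$ is $\mathbb{R}^4$ with the metric $\langle\cdot,\cdot\rangle$ given by $dx_1^2+dx_2^2-dx_3^2-dx_4^2$, and $e_1,e_2,e_3,e_4$ is a fixed orthonormal basis with $\langle e_1,e_1\rangle=\langle e_2,e_2\rangle=1$, $\langle e_3,e_3\rangle=\langle e_4,e_4\rangle=-1$. Put $\xi_1=\frac{e_2+e_4}{\sqrt2}$, $\xi_2=\frac{-e_2+e_4}{\sqrt2}$, so that $\langle\xi_1,\xi_1\rangle=\langle\xi_2,\xi_2\rangle=0$, $\langle\xi_1,\xi_2\rangle=-1$. Let $I,J\subset\mathbb{R}$ be open intervals, $f,g:I\to\mathbb{R}$ and $\varphi:J\to\mathbb{R}$ smooth with $f>0$. Primes denote derivatives with respect to $u$ and dots denote derivatives of $\varphi$ with respect to $v$. The surface $\mathcal{M}_m$ given by $z(u,v)$ is called a meridian surface; its first fundamental form has coefficients $E=-2f'g'$, $F=0$, $G=f^2(\dot\varphi^2-\varphi^2)$. Only Lorentz surfaces (induced metric of signature $(1,1)$) are considered, so it is assumed that either $\dot\varphi^2-\varphi^2>0$ on $J$ and $f'g'>0$ on $I$ (then put $\varepsilon=1$), or $\dot\varphi^2-\varphi^2<0$ on $J$ and $f'g'<0$ on $I$ (then put $\varepsilon=-1$). The parameter $u$ is normalized so that $2\varepsilon f'g'=1$. The meridian curve $m$ is the curve determined by the functions $f(u),g(u)$; the $u$-lines $v=\mathrm{const}$ of $\mathcal{M}_m$ are its (mutually congruent) copies. The curve $c$ is $l(v)=\varphi(v)\cosh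 v\,e_1+\varphi(v)\sinh v\,e_3+\frac{\varphi^2(v)}{2}\xi_1+\xi_2$, $v\in J$ (the name $c$ of this curve is unrelated to the constants $c$ in (i) and (ii)), and its curvature is $$\kappa(v)=\frac{\varphi\ddot\varphi-2\dot\varphi^2+\varphi^2}{\left(\varepsilon(\dot\varphi^2-\varphi^2)\right)^{3/2}}.$$ The mean curvature vector field is $H=\frac12\,\mathrm{tr}\,h$, where $h$ is the second fundamental form and the trace is taken with respect to the induced metric. The normal connection $D$ is given by $D_X\xi=$ the normal part of $\overline\nabla_X\xi$ for tangent $X$ and normal $\xi$, where $\overline\nabla$ is the flat connection of $\mathbb{E}^4_2$. A normal vector field $\xi$ is parallel if $D\xi=0$ identically; the surface has parallel mean curvature vector if $DH=0$. The surface has parallel normalized mean curvature vector field if $H$ is non-zero with $\langle H,H\rangle\neq0$ everywhere and there is a smooth unit vector field $H_0$ (i.e. $\langle H_0,H_0\rangle=\pm1$) in the direction of $H$ such that $DH_0=0$. *)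

theory Defs
  imports "HOL-Analysis.Analysis"
begin

text \<open>
  \<open>higher_differentiable_on\<close> is meant for open sets: then \<open>frechet_derivative f (at x)\<close> depends
  only on the values of \<open>f\<close> on the set.
\<close>

primrec higher_differentiable_on ::
  "'a::real_normed_vector set \<Rightarrow> ('a \<Rightarrow> 'b::real_normed_vector) \<Rightarrow> nat \<Rightarrow> bool" where
  "higher_differentiable_on S f 0 \<longleftrightarrow> continuous_on S f"
| "higher_differentiable_on S f (Suc n) \<longleftrightarrow>
     (\<forall>x\<in>S. f differentiable (at x)) \<and>
     (\<forall>w. higher_differentiable_on S (\<lambda>x. frechet_derivative f (at x) w) n)"

definition smooth_on ::
  "'a::real_normed_vector set \<Rightarrow> ('a \<Rightarrow> 'b::real_normed_vector) \<Rightarrow> bool" where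
  "smooth_on S f \<longleftrightarrow> (\<forall>n. higher_differentiable_on S f n)"

definition open_interval :: "real set \<Rightarrow> bool" where
  "open_interval S \<longleftrightarrow> open S \<and> is_interval S \<and> S \<noteq> {}"


section \<open>The pseudo-Euclidean space of dimension 4 and index 2\<close>

text \<open>The index type \<open>4\<close> of \<open>real^4\<close> has the elements \<open>1, 2, 3, 4\<close> (with \<open>4 = 0\<close>).\<close>

definition ip :: "real^4 \<Rightarrow> real^4 \<Rightarrow> real" where
  "ip x y = x $ 1 * y $ 1 + x $ 2 * y $ 2 - x $ 3 * y $ 3 - x $ 4 * y $ 4"

definition pseudo_orthonormal :: "(4 \<Rightarrow> real^4) \<Rightarrow> bool" where
  "pseudo_orthonormal e \<longleftrightarrow>
     (\<forall>i j. ip (e i) (e j) = (if i \<noteq> j then 0 else if i = 1 \<or> i = 2 then 1 else -1))"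

definition xi1 :: "(4 \<Rightarrow> real^4) \<Rightarrow> real^4" where
  "xi1 e = (1 / sqrt 2) *\<^sub>R (e 2 + e 4)"

definition xi2 :: "(4 \<Rightarrow> real^4) \<Rightarrow> real^4" where
  "xi2 e = (1 / sqrt 2) *\<^sub>R (- e 2 + e 4)"


section \<open>Extrinsic geometry of parametrized surfaces\<close>

text \<open>
  A surface is given by a parametrization \<open>z\<close>, regarded as a map on the \<open>(u,v)\<close>-plane. Tangent
  directions at the parameter point \<open>p\<close> are represented by vectors \<open>a\<close> of the parameter plane
  (the tangent vector itself being \<open>dz(a)\<close>), and vector fields along the surface by functions of
  the parameter point. With this, \<open>D_flat a F\<close> is the flat connection of the ambient space.
\<close>

definition D_flat :: "real \<times> real \<Rightarrow> (real \<times> real \<Rightarrow> real^4) \<Rightarrow> real \<times> real \<Rightarrow> real^4" where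
  "D_flat a F p = frechet_derivative F (at p) a"

definition tangent_space :: "(real \<times> real \<Rightarrow> real^4) \<Rightarrow> real \<times> real \<Rightarrow> (real^4) set" where
  "tangent_space z p = range (\<lambda>a. D_flat a z p)"

definition normal_space :: "(real \<times> real \<Rightarrow> real^4) \<Rightarrow> real \<times> real \<Rightarrow> (real^4) set" where
  "normal_space z p = {n. \<forall>t\<in>tangent_space z p. ip t n = 0}"

text \<open>
  Meaningful only where the induced metric is nondegenerate, so that the ambient space is the direct
  sum of the tangent and the normal space.
\<close>

definition normal_part :: "(real \<times> real \<Rightarrow> real^4) \<Rightarrow> real \<times> real \<Rightarrow> real^4 \<Rightarrow> real^4" where
  "normal_part z p w = (THE n. n \<in> normal_space z p \<and> w - n \<in> tangent_space z p)"

definition first_form ::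
  "(real \<times> real \<Rightarrow> real^4) \<Rightarrow> real \<times> real \<Rightarrow> real \<times> real \<Rightarrow> real \<times> real \<Rightarrow> real" where
  "first_form z p a b = ip (D_flat a z p) (D_flat b z p)"

text \<open>Gauss formula, applied to the coordinate fields with constant components \<open>a\<close> and \<open>b\<close>.\<close>

definition second_form ::
  "(real \<times> real \<Rightarrow> real^4) \<Rightarrow> real \<times> real \<Rightarrow> real \<times> real \<Rightarrow> real \<times> real \<Rightarrow> real^4" where
  "second_form z p a b = normal_part z p (D_flat a (D_flat b z) p)"

text \<open>
  One half of the contraction of the second fundamental form with the inverse of the matrix of the
  first fundamental form, whose coefficients are \<open>E\<close>, \<open>F\<close>, \<open>G\<close>.
\<close>

definition mean_curvature_vector :: "(real \<times> real \<Rightarrow> real^4) \<Rightarrow> real \<times> real \<Rightarrow> real^4" where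
  "mean_curvature_vector z p =
     (let E = first_form z p (1,0) (1,0);
          F = first_form z p (1,0) (0,1);
          G = first_form z p (0,1) (0,1)
      in (1 / 2) *\<^sub>R (1 / (E * G - F\<^sup>2)) *\<^sub>R
           (G *\<^sub>R second_form z p (1,0) (1,0)
            - F *\<^sub>R second_form z p (1,0) (0,1)
            - F *\<^sub>R second_form z p (0,1) (1,0)
            + E *\<^sub>R second_form z p (0,1) (0,1)))"

definition normal_connection ::
  "(real \<times> real \<Rightarrow> real^4) \<Rightarrow> real \<times> real \<Rightarrow> (real \<times> real \<Rightarrow> real^4) \<Rightarrow> real \<times> real \<Rightarrow> real^4" where
  "normal_connection z a \<xi> p = normal_part z p (D_flat a \<xi> p)"

definition parallel_normal_field ::
  "(real \<times> real) set \<Rightarrow> (real \<times> real \<Rightarrow> real^4) \<Rightarrow> (real \<times> real \<Rightarrow> real^4) \<Rightarrow> bool" where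
  "parallel_normal_field U z \<xi> \<longleftrightarrow> (\<forall>p\<in>U. \<forall>a. normal_connection z a \<xi> p = 0)"

definition parallel_mean_curvature ::
  "(real \<times> real) set \<Rightarrow> (real \<times> real \<Rightarrow> real^4) \<Rightarrow> bool" where
  "parallel_mean_curvature U z \<longleftrightarrow> parallel_normal_field U z (mean_curvature_vector z)"

definition parallel_normalized_mean_curvature ::
  "(real \<times> real) set \<Rightarrow> (real \<times> real \<Rightarrow> real^4) \<Rightarrow> bool" where
  "parallel_normalized_mean_curvature U z \<longleftrightarrow>
     (let H = mean_curvature_vector z in
        (\<forall>p\<in>U. H p \<noteq> 0 \<and> ip (H p) (H p) \<noteq> 0) \<and>
        (\<exists>H0. smooth_on U H0 \<and>
              (\<forall>p\<in>U. ip (H0 p) (H0 p) = 1 \<or> ip (H0 p) (H0 p) = -1) \<and>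
              (\<forall>p\<in>U. \<exists>r>0. H0 p = r *\<^sub>R H p) \<and>
              parallel_normal_field U z H0))"


section \<open>Meridian surfaces\<close>

definition curve_c :: "(4 \<Rightarrow> real^4) \<Rightarrow> (real \<Rightarrow> real) \<Rightarrow> real \<Rightarrow> real^4" where
  "curve_c e \<phi> v =
     (\<phi> v * cosh v) *\<^sub>R e 1 + (\<phi> v * sinh v) *\<^sub>R e 3 + ((\<phi> v)\<^sup>2 / 2) *\<^sub>R xi1 e + xi2 e"

definition curvature_c :: "real \<Rightarrow> (real \<Rightarrow> real) \<Rightarrow> real \<Rightarrow> real" where
  "curvature_c \<epsilon> \<phi> v =
     (\<phi> v * deriv (deriv \<phi>) v - 2 * (deriv \<phi> v)\<^sup>2 + (\<phi> v)\<^sup>2)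
       / (\<epsilon> * ((deriv \<phi> v)\<^sup>2 - (\<phi> v)\<^sup>2)) powr (3 / 2)"

definition meridian_surface ::
  "(4 \<Rightarrow> real^4) \<Rightarrow> (real \<Rightarrow> real) \<Rightarrow> (real \<Rightarrow> real) \<Rightarrow> (real \<Rightarrow> real) \<Rightarrow> real \<times> real \<Rightarrow> real^4" where
  "meridian_surface e f g \<phi> = (\<lambda>(u, v). f u *\<^sub>R curve_c e \<phi> v + g u *\<^sub>R xi1 e)"

end

theory Submission
  imports Defs
begin

text \<open>
  Along the curve \<open>l = curve_c e \<phi>\<close>, whose position vectors are null with
  \<open>\<langle>l, xi1\<rangle> = -1\<close>, the vectors \<open>l'\<close> and a suitable unit vector \<open>n1 v\<close> span the orthogonal complement
  of the plane of \<open>l\<close> and \<open>xi1\<close>. The tangent plane of the surface is spanned by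
  \<open>zu = f' l + g' xi1\<close> and \<open>zv = f l'\<close>, the normal plane by \<open>n1 v\<close> and by \<open>n2 u v = f' l - g' xi1\<close>.
  Differentiating \<open>n1\<close> and \<open>n2\<close> gives tangent vectors, so both are parallel and the normal connection
  is trivial in this frame (\<open>derivative_W\<close>). The second derivatives of the surface give
  \[ H = -\frac{1}{2f}\,(\kappa\, n_1 + \varepsilon M\, n_2), \qquad
     M = \frac{(ff')'}{f'} = \frac{f f'' + f'^2}{f'} \]
  (\<open>mean_curvature_eq\<close>). Here \<open>\<kappa>\<close> depends on \<open>v\<close> alone, and \<open>f\<close> and \<open>M\<close> on \<open>u\<close> alone.

  A normalization of \<open>H\<close> can be parallel only if its coefficients in a parallel frame are constant. As
  \<open>\<kappa>\<close> is not identically zero, this means that \<open>\<kappa>\<close> has no zero and that \<open>M u = \<mu> * \<kappa> v\<close> for a constant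
  \<open>\<mu>\<close>; the mean curvature vector is not null exactly if \<open>\<mu>\<^sup>2 \<noteq> 1\<close>
  (\<open>parallel_normalized_imp_ratio\<close>, \<open>ratio_imp_parallel_normalized\<close>). In that case \<open>H\<close> is \<open>\<kappa>/f\<close> times
  a nonzero parallel field. It is never parallel itself, because \<open>f' \<noteq> 0\<close> makes this factor vary with
  \<open>u\<close> (\<open>ratio_imp_not_parallel\<close>).

  Finally the variables separate. Either \<open>\<mu> = 0\<close>, that is \<open>(f f')' = 0\<close>, whence \<open>f\<^sup>2\<close> is affine in \<open>u\<close>:
  case (i). Or both \<open>\<kappa>\<close> and \<open>M\<close> are nonzero constants, and \<open>(f f')' = c f'\<close> integrates to
  \<open>f f' = c f + b\<close>: case (ii).
\<close>

section \<open>Smooth functions\<close>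

lemma higher_differentiable_on_cong:
  assumes "open S" and "\<And>x. x \<in> S \<Longrightarrow> f x = g x" and "higher_differentiable_on S f n"
  shows "higher_differentiable_on S g n"
  using assms(2,3)
proof (induction n arbitrary: f g)
  case 0
  then show ?case by (simp cong: continuous_on_cong)
next
  case (Suc n)
  have g: "(g has_derivative frechet_derivative f (at x)) (at x)" if "x \<in> S" for x
  proof (rule has_derivative_transform_within_open[OF _ assms(1) that])
    show "(f has_derivative frechet_derivative f (at x)) (at x)"
      using Suc.prems(2) that frechet_derivative_works by auto
  qed (use Suc.prems(1) in auto)
  then have "g differentiable (at x)" if "x \<in> S" for x
    using that unfolding differentiable_def by blast
  moreover have "higher_differentiable_on S (\<lambda>x. frechet_derivative g (at x) w) n" for w
  proof (rule Suc.IH)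
    show "higher_differentiable_on S (\<lambda>x. frechet_derivative f (at x) w) n"
      using Suc.prems(2) by simp
    show "frechet_derivative f (at x) w = frechet_derivative g (at x) w" if "x \<in> S" for x
      using frechet_derivative_at[OF g[OF that]] by simp
  qed
  ultimately show ?case by simp
qed

text \<open>
  The derivative only has to be known on \<open>S\<close>, in any explicit form; this turns every closure
  property below into an induction on the order of differentiability.
\<close>

lemma higher_differentiable_on_SucI:
  assumes "open S" and der: "\<And>x. x \<in> S \<Longrightarrow> (f has_derivative f' x) (at x)"
    and hd: "\<And>w. higher_differentiable_on S (\<lambda>x. f' x w) n"
  shows "higher_differentiable_on S f (Suc n)"
proof -
  have "higher_differentiable_on S (\<lambda>x. frechet_derivative f (at x) w) n" for w
    by (rule higher_differentiable_on_cong[OF assms(1) _ hd[of w]])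
      (use frechet_derivative_at[OF der] in auto)
  moreover have "f differentiable (at x)" if "x \<in> S" for x
    using der[OF that] unfolding differentiable_def by blast
  ultimately show ?thesis by simp
qed

lemma higher_differentiable_on_Suc_has_derivative:
  assumes "higher_differentiable_on S f (Suc n)" "x \<in> S"
  shows "(f has_derivative frechet_derivative f (at x)) (at x)"
  using assms frechet_derivative_works by auto

lemma higher_differentiable_on_SucD:
  assumes "higher_differentiable_on S f (Suc n)"
  shows "higher_differentiable_on S f n"
  using assms
proof (induction n arbitrary: f)
  case 0
  then show ?case
    by (auto intro!: continuous_at_imp_continuous_on differentiable_imp_continuous_within)
next
  case (Suc n)
  have "higher_differentiable_on S (\<lambda>x. frechet_derivative f (at x) w) n" for w
    by (rule Suc.IH) (use Suc.prems in simp)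
  then show ?case using Suc.prems by simp
qed

lemma higher_differentiable_on_const:
  assumes "open S" shows "higher_differentiable_on S (\<lambda>x. c) n"
proof (induction n arbitrary: c)
  case (Suc n)
  show ?case by (rule higher_differentiable_on_SucI[OF assms has_derivative_const]) (rule Suc)
qed simp

lemma higher_differentiable_on_add:
  assumes "open S" "higher_differentiable_on S f n" "higher_differentiable_on S g n"
  shows "higher_differentiable_on S (\<lambda>x. f x + g x) n"
  using assms(2,3)
proof (induction n arbitrary: f g)
  case 0
  then show ?case by (auto intro: continuous_intros)
next
  case (Suc n)
  show ?case
  proof (rule higher_differentiable_on_SucI[OF assms(1)])
    show "((\<lambda>x. f x + g x) has_derivative
        (\<lambda>w. frechet_derivative f (at x) w + frechet_derivative g (at x) w)) (at x)"
      if "x \<in> S" for x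
      by (intro has_derivative_add
          higher_differentiable_on_Suc_has_derivative[OF Suc.prems(1) that]
          higher_differentiable_on_Suc_has_derivative[OF Suc.prems(2) that])
  qed (use Suc in auto)
qed

lemma higher_differentiable_on_scaleR:
  fixes f :: "'a::real_normed_vector \<Rightarrow> real" and g :: "'a \<Rightarrow> 'b::real_normed_vector"
  assumes "open S" "higher_differentiable_on S f n" "higher_differentiable_on S g n"
  shows "higher_differentiable_on S (\<lambda>x. f x *\<^sub>R g x) n"
  using assms(2,3)
proof (induction n arbitrary: f g)
  case 0
  then show ?case by (auto intro: continuous_intros)
next
  case (Suc n)
  show ?case
  proof (rule higher_differentiable_on_SucI[OF assms(1)])
    show "((\<lambda>x. f x *\<^sub>R g x) has_derivative
        (\<lambda>w. f x *\<^sub>R frechet_derivative g (at x) w + frechet_derivative f (at x) w *\<^sub>R g x)) (at x)"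
      if "x \<in> S" for x
      by (intro has_derivative_scaleR
          higher_differentiable_on_Suc_has_derivative[OF Suc.prems(1) that]
          higher_differentiable_on_Suc_has_derivative[OF Suc.prems(2) that])
    show "higher_differentiable_on S
        (\<lambda>x. f x *\<^sub>R frechet_derivative g (at x) w + frechet_derivative f (at x) w *\<^sub>R g x) n" for w
      using Suc.prems Suc.prems[THEN higher_differentiable_on_SucD]
      by (intro higher_differentiable_on_add[OF assms(1)] Suc.IH) auto
  qed
qed

text \<open>
  No product occurs here: the directional derivative of \<open>f \<circ> L\<close> in direction \<open>w\<close> is the one of \<open>f\<close> in
  the fixed direction \<open>L w\<close>, again composed with \<open>L\<close>.
\<close>

lemma higher_differentiable_on_compose_linear:
  assumes "open S" "bounded_linear L" "L ` S \<subseteq> T" "higher_differentiable_on T f n"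
  shows "higher_differentiable_on S (\<lambda>x. f (L x)) n"
  using assms(4)
proof (induction n arbitrary: f)
  case 0
  have "continuous_on S L" by (rule linear_continuous_on[OF assms(2)])
  then show ?case
    using 0 assms(3) continuous_on_compose2[of T f S L] by auto
next
  case (Suc n)
  show ?case
  proof (rule higher_differentiable_on_SucI[OF assms(1)])
    show "((\<lambda>x. f (L x)) has_derivative (\<lambda>w. frechet_derivative f (at (L x)) (L w))) (at x)"
      if "x \<in> S" for x
    proof -
      have "L x \<in> T" using that assms(3) by auto
      from higher_differentiable_on_Suc_has_derivative[OF Suc.prems this]
      show ?thesis
        by (rule has_derivative_compose[OF bounded_linear_imp_has_derivative[OF assms(2)]])
    qed
    show "higher_differentiable_on S (\<lambda>x. frechet_derivative f (at (L x)) (L w)) n" for w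
      by (rule Suc.IH) (use Suc.prems in simp)
  qed
qed

lemma higher_differentiable_on_compose_real:
  fixes f :: "'a::real_normed_vector \<Rightarrow> real" and F :: "real \<Rightarrow> real"
  assumes "open S" "f ` S \<subseteq> T" "higher_differentiable_on S f n" "higher_differentiable_on T F n"
  shows "higher_differentiable_on S (\<lambda>x. F (f x)) n"
  using assms(3,4)
proof (induction n arbitrary: F)
  case 0
  then show ?case
    using assms(2) continuous_on_compose2[of T F S f] by auto
next
  case (Suc n)
  show ?case
  proof (rule higher_differentiable_on_SucI[OF assms(1)])
    show "((\<lambda>x. F (f x)) has_derivative
        (\<lambda>w. frechet_derivative f (at x) w *\<^sub>R frechet_derivative F (at (f x)) 1)) (at x)"
      if "x \<in> S" for x
    proof -
      have "f x \<in> T" using that assms(2) by auto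
      note F = higher_differentiable_on_Suc_has_derivative[OF Suc.prems(2) this]
      have "((\<lambda>x. F (f x)) has_derivative
          (\<lambda>w. frechet_derivative F (at (f x)) (frechet_derivative f (at x) w))) (at x)"
        by (rule has_derivative_compose
            [OF higher_differentiable_on_Suc_has_derivative[OF Suc.prems(1) that] F])
      then show ?thesis
      proof (rule has_derivative_eq_rhs)
        show "(\<lambda>w. frechet_derivative F (at (f x)) (frechet_derivative f (at x) w)) =
            (\<lambda>w. frechet_derivative f (at x) w *\<^sub>R frechet_derivative F (at (f x)) 1)"
        proof
          show "frechet_derivative F (at (f x)) (frechet_derivative f (at x) w) =
              frechet_derivative f (at x) w *\<^sub>R frechet_derivative F (at (f x)) 1" for w
            using linear_scale[OF has_derivative_linear[OF F], of "frechet_derivative f (at x) w" 1]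
            by simp
        qed
      qed
    qed
    show "higher_differentiable_on S
        (\<lambda>x. frechet_derivative f (at x) w *\<^sub>R frechet_derivative F (at (f x)) 1) n" for w
    proof (rule higher_differentiable_on_scaleR[OF assms(1)])
      show "higher_differentiable_on S (\<lambda>x. frechet_derivative F (at (f x)) 1) n"
        by (rule Suc.IH[OF higher_differentiable_on_SucD[OF Suc.prems(1)]]) (use Suc.prems(2) in simp)
    qed (use Suc.prems in auto)
  qed
qed

lemma smooth_on_cong:
  assumes "open S" "smooth_on S f" "\<And>x. x \<in> S \<Longrightarrow> f x = g x"
  shows "smooth_on S g"
  unfolding smooth_on_def
proof
  show "higher_differentiable_on S g n" for n
    by (rule higher_differentiable_on_cong[OF assms(1,3)])
      (use assms(2) in \<open>auto simp: smooth_on_def\<close>)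
qed

lemma smooth_on_const: "open S \<Longrightarrow> smooth_on S (\<lambda>x. c)"
  by (simp add: smooth_on_def higher_differentiable_on_const)

lemma smooth_on_add: "open S \<Longrightarrow> smooth_on S f \<Longrightarrow> smooth_on S g \<Longrightarrow> smooth_on S (\<lambda>x. f x + g x)"
  by (simp add: smooth_on_def higher_differentiable_on_add)

lemma smooth_on_scaleR:
  fixes f :: "'a::real_normed_vector \<Rightarrow> real" and g :: "'a \<Rightarrow> 'b::real_normed_vector"
  shows "open S \<Longrightarrow> smooth_on S f \<Longrightarrow> smooth_on S g \<Longrightarrow> smooth_on S (\<lambda>x. f x *\<^sub>R g x)"
  by (simp add: smooth_on_def higher_differentiable_on_scaleR)

lemma smooth_on_mult:
  fixes f g :: "'a::real_normed_vector \<Rightarrow> real"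
  shows "open S \<Longrightarrow> smooth_on S f \<Longrightarrow> smooth_on S g \<Longrightarrow> smooth_on S (\<lambda>x. f x * g x)"
  using smooth_on_scaleR[of S f g] by simp

lemma smooth_on_diff:
  fixes f g :: "'a::real_normed_vector \<Rightarrow> 'b::real_normed_vector"
  assumes "open S" "smooth_on S f" "smooth_on S g"
  shows "smooth_on S (\<lambda>x. f x - g x)"
proof -
  have "smooth_on S (\<lambda>x. f x + (-1) *\<^sub>R g x)"
    by (intro smooth_on_add smooth_on_scaleR smooth_on_const assms)
  then show ?thesis by simp
qed

lemma smooth_on_power2:
  fixes f :: "'a::real_normed_vector \<Rightarrow> real"
  shows "open S \<Longrightarrow> smooth_on S f \<Longrightarrow> smooth_on S (\<lambda>x. (f x)\<^sup>2)"
  using smooth_on_mult[of S f f] by (simp add: power2_eq_square)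

lemma smooth_on_compose_fst:
  assumes "open S" "open T" "smooth_on S f"
  shows "smooth_on (S \<times> T) (\<lambda>p. f (fst p))"
  unfolding smooth_on_def
proof
  show "higher_differentiable_on (S \<times> T) (\<lambda>p. f (fst p)) n" for n
  proof (rule higher_differentiable_on_compose_linear[OF open_Times[OF assms(1,2)] bounded_linear_fst])
    show "higher_differentiable_on S f n" using assms(3) unfolding smooth_on_def by blast
  qed auto
qed

lemma smooth_on_compose_snd:
  assumes "open S" "open T" "smooth_on T f"
  shows "smooth_on (S \<times> T) (\<lambda>p. f (snd p))"
  unfolding smooth_on_def
proof
  show "higher_differentiable_on (S \<times> T) (\<lambda>p. f (snd p)) n" for n
  proof (rule higher_differentiable_on_compose_linear[OF open_Times[OF assms(1,2)] bounded_linear_snd])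
    show "higher_differentiable_on T f n" using assms(3) unfolding smooth_on_def by blast
  qed auto
qed

lemma smooth_on_powr:
  fixes f :: "'a::real_normed_vector \<Rightarrow> real"
  assumes "open S" "smooth_on S f" "\<And>x. x \<in> S \<Longrightarrow> f x > 0"
  shows "smooth_on S (\<lambda>x. f x powr s)"
proof -
  have powr: "higher_differentiable_on {0<..} (\<lambda>x::real. x powr s) n" for n
  proof (induction n arbitrary: s)
    case 0
    then show ?case by (auto intro!: continuous_intros)
  next
    case (Suc n)
    show ?case
    proof (rule higher_differentiable_on_SucI)
      show "((\<lambda>x::real. x powr s) has_derivative (\<lambda>w. (s * w) *\<^sub>R (x powr (s - 1)))) (at x)"
        if "x \<in> {0<..}" for x
        using that
        by (intro has_derivative_eq_rhs[OF has_real_derivative_powr[unfolded has_field_derivative_def]])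
          (auto simp: fun_eq_iff)
      show "higher_differentiable_on {0<..} (\<lambda>x. (s * w) *\<^sub>R (x powr (s - 1))) n" for w
        by (intro higher_differentiable_on_scaleR higher_differentiable_on_const Suc) auto
    qed auto
  qed
  have f: "higher_differentiable_on S f n" for n
    using assms(2) unfolding smooth_on_def by blast
  have "higher_differentiable_on S (\<lambda>x. f x powr s) n" for n
    by (rule higher_differentiable_on_compose_real[OF assms(1) _ f powr]) (use assms(3) in auto)
  then show ?thesis unfolding smooth_on_def by blast
qed

text \<open>
  The two functions are derivatives of each other, so the induction has to treat them together.
\<close>

lemma smooth_on_cosh_sinh:
  fixes S :: "real set"
  assumes "open S"
  shows "smooth_on S cosh" "smooth_on S sinh"
proof -
  have "higher_differentiable_on S (cosh :: real \<Rightarrow> real) n \<and>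
        higher_differentiable_on S (sinh :: real \<Rightarrow> real) n" for n
  proof (induction n)
    case 0
    then show ?case by (auto intro!: continuous_intros)
  next
    case (Suc n)
    have "((cosh :: real \<Rightarrow> real) has_derivative (\<lambda>w. w *\<^sub>R sinh x)) (at x)" for x
      by (rule has_derivative_eq_rhs[OF has_field_derivative_cosh[OF DERIV_ident,
              unfolded has_field_derivative_def]]) (simp add: fun_eq_iff)
    moreover have "((sinh :: real \<Rightarrow> real) has_derivative (\<lambda>w. w *\<^sub>R cosh x)) (at x)" for x
      by (rule has_derivative_eq_rhs[OF has_field_derivative_sinh[OF DERIV_ident,
              unfolded has_field_derivative_def]]) (simp add: fun_eq_iff)
    moreover have "higher_differentiable_on S (\<lambda>x. w *\<^sub>R sinh x) n"
      "higher_differentiable_on S (\<lambda>x. w *\<^sub>R cosh x) n" for w :: real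
      using Suc
      by (auto simp del: real_scaleR_def
          intro!: higher_differentiable_on_scaleR higher_differentiable_on_const assms)
    ultimately show ?case
      using higher_differentiable_on_SucI[OF assms, of cosh "\<lambda>x w. w *\<^sub>R sinh x" n]
        higher_differentiable_on_SucI[OF assms, of sinh "\<lambda>x w. w *\<^sub>R cosh x" n] by blast
  qed
  then show "smooth_on S cosh" "smooth_on S sinh" by (auto simp: smooth_on_def)
qed

lemma smooth_on_has_derivative:
  assumes "smooth_on S f" "x \<in> S"
  shows "(f has_derivative frechet_derivative f (at x)) (at x)"
proof (rule higher_differentiable_on_Suc_has_derivative[OF _ assms(2)])
  show "higher_differentiable_on S f (Suc 0)"
    using assms(1) unfolding smooth_on_def by blast
qed

lemma smooth_on_has_real_derivative:
  fixes f :: "real \<Rightarrow> real"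
  assumes "smooth_on S f" "x \<in> S"
  shows "(f has_real_derivative deriv f x) (at x)"
proof -
  have "f differentiable (at x)"
    using smooth_on_has_derivative[OF assms] unfolding differentiable_def by blast
  then show ?thesis by (simp add: DERIV_deriv_iff_real_differentiable)
qed

lemma smooth_on_deriv:
  fixes f :: "real \<Rightarrow> real"
  assumes "open S" "smooth_on S f"
  shows "smooth_on S (deriv f)"
proof (rule smooth_on_cong[OF assms(1)])
  show "smooth_on S (\<lambda>x. frechet_derivative f (at x) 1)"
    unfolding smooth_on_def
  proof
    show "higher_differentiable_on S (\<lambda>x. frechet_derivative f (at x) 1) n" for n
    proof -
      have "higher_differentiable_on S f (Suc n)" using assms(2) unfolding smooth_on_def by blast
      then show ?thesis by simp
    qed
  qed
  show "frechet_derivative f (at x) 1 = deriv f x" if "x \<in> S" for x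
    using fun_cong[OF frechet_derivative_at[OF smooth_on_has_real_derivative[OF assms(2) that,
          unfolded has_field_derivative_def]], of 1] by simp
qed

section \<open>The frame of a meridian surface\<close>

lemma bounded_bilinear_ip: "bounded_bilinear ip"
proof
  show "\<exists>K. \<forall>x y. norm (ip x y) \<le> norm x * norm y * K"
  proof (intro exI allI)
    fix x y :: "real^4"
    have "\<bar>x $ i * y $ i\<bar> \<le> norm x * norm y" for i
      by (simp add: abs_mult mult_mono component_le_norm_cart)
    from this[of 1] this[of 2] this[of 3] this[of 4]
    show "norm (ip x y) \<le> norm x * norm y * 4" by (simp add: ip_def abs_le_iff)
  qed
qed (auto simp: ip_def algebra_simps)

interpretation ip: bounded_bilinear ip by (rule bounded_bilinear_ip)

lemmas ip_simps = ip.add_left ip.add_right ip.diff_left ip.diff_right ip.minus_left ip.minus_right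
  ip.scaleR_left ip.scaleR_right ip.zero_left ip.zero_right

lemma ip_commute: "ip x y = ip y x"
  by (simp add: ip_def mult.commute)

lemma D_flat_eqI: "(F has_derivative F') (at p) \<Longrightarrow> D_flat a F p = F' a"
  unfolding D_flat_def by (simp add: frechet_derivative_at[symmetric])

text \<open>
  A meridian surface, its coordinate tangent fields and the normal fields of its frame are sums of such products of a
  function of \<open>u\<close> and a vector function of \<open>v\<close>.
\<close>

lemma has_derivative_field:
  assumes "(x has_real_derivative x') (at u)" "(X has_vector_derivative X') (at v)"
  shows "((\<lambda>p. x (fst p) *\<^sub>R X (snd p)) has_derivative
      (\<lambda>w. (fst w * x') *\<^sub>R X v + (snd w * x u) *\<^sub>R X')) (at (u, v))"
proof -
  have 1: "((\<lambda>p. x (fst p)) has_derivative (\<lambda>w. x' * fst w)) (at (u, v))"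
    using has_derivative_compose[OF has_derivative_fst[OF has_derivative_ident], of x "(*) x'" "(u, v)" UNIV]
      assms(1) by (simp add: has_field_derivative_def)
  have 2: "((\<lambda>p. X (snd p)) has_derivative (\<lambda>w. snd w *\<^sub>R X')) (at (u, v))"
    using has_derivative_compose[OF has_derivative_snd[OF has_derivative_ident], of X "\<lambda>y. y *\<^sub>R X'" "(u, v)" UNIV]
      assms(2) by (simp add: has_vector_derivative_def)
  show ?thesis
    by (rule has_derivative_eq_rhs[OF has_derivative_scaleR[OF 1 2]])
      (auto simp: fun_eq_iff algebra_simps)
qed

text \<open>
  The sign \<open>\<epsilon>\<close> ties the causal character of the curve to that of the meridian: the normalization gives
  \<open>f' g'\<close> the sign of \<open>\<epsilon>\<close>, so the first fundamental form has \<open>E = - \<epsilon>\<close> and \<open>\<epsilon> G > 0\<close>.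
\<close>

locale meridian =
  fixes e :: "4 \<Rightarrow> real^4" and I J :: "real set" and f g \<phi> :: "real \<Rightarrow> real" and \<epsilon> :: real
  assumes basis: "pseudo_orthonormal e"
    and intervals: "open_interval I" "open_interval J"
    and smooth: "smooth_on I f" "smooth_on I g" "smooth_on J \<phi>"
    and f_pos: "u \<in> I \<Longrightarrow> f u > 0"
    and eps: "\<epsilon> = 1 \<or> \<epsilon> = -1"
    and lorentz: "v \<in> J \<Longrightarrow> \<epsilon> * ((deriv \<phi> v)\<^sup>2 - (\<phi> v)\<^sup>2) > 0"
    and normalization: "u \<in> I \<Longrightarrow> 2 * \<epsilon> * deriv f u * deriv g u = 1"
begin

text \<open>
  The vectors \<open>ea v\<close> and \<open>eb v\<close> form a pseudo-orthonormal basis of the plane of \<open>e 1\<close> and \<open>e 3\<close>, rotated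
  hyperbolically along with the curve; each is the derivative of the other. All fields are expanded in
  \<open>ea\<close>, \<open>eb\<close>, \<open>xi1\<close> and \<open>xi2\<close>.
\<close>

definition ea :: "real \<Rightarrow> real^4" where
  "ea v = cosh v *\<^sub>R e 1 + sinh v *\<^sub>R e 3"

definition eb :: "real \<Rightarrow> real^4" where
  "eb v = sinh v *\<^sub>R e 1 + cosh v *\<^sub>R e 3"

definition speed_sq :: "real \<Rightarrow> real" where
  "speed_sq v = (deriv \<phi> v)\<^sup>2 - (\<phi> v)\<^sup>2"

definition curvature_numerator :: "real \<Rightarrow> real" where
  "curvature_numerator v = \<phi> v * deriv (deriv \<phi>) v - 2 * (deriv \<phi> v)\<^sup>2 + (\<phi> v)\<^sup>2"

abbreviation \<kappa> :: "real \<Rightarrow> real" where "\<kappa> \<equiv> curvature_c \<epsilon> \<phi>"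
abbreviation z :: "real \<times> real \<Rightarrow> real^4" where "z \<equiv> meridian_surface e f g \<phi>"

definition velocity :: "real \<Rightarrow> real^4" where
  "velocity v = deriv \<phi> v *\<^sub>R ea v + \<phi> v *\<^sub>R eb v + (\<phi> v * deriv \<phi> v) *\<^sub>R xi1 e"

text \<open>
  The combination of \<open>ea\<close>, \<open>eb\<close> and \<open>xi1\<close> that is orthogonal to the position and the velocity of the
  curve; its squared length before scaling is \<open>- speed_sq v\<close>.
\<close>

definition n1 :: "real \<Rightarrow> real^4" where
  "n1 v = ((\<epsilon> * speed_sq v) powr (-1/2)) *\<^sub>R (\<phi> v *\<^sub>R ea v + deriv \<phi> v *\<^sub>R eb v + (\<phi> v)\<^sup>2 *\<^sub>R xi1 e)"

text \<open>
  Here and in \<open>n2\<close> the derivative of \<open>g\<close> is replaced by its value from the normalization, so that the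
  meridian enters only through \<open>f\<close>.
\<close>

definition zu :: "real \<Rightarrow> real \<Rightarrow> real^4" where
  "zu u v = deriv f u *\<^sub>R curve_c e \<phi> v + (\<epsilon> / (2 * deriv f u)) *\<^sub>R xi1 e"

definition zv :: "real \<Rightarrow> real \<Rightarrow> real^4" where
  "zv u v = f u *\<^sub>R velocity v"

definition n2 :: "real \<Rightarrow> real \<Rightarrow> real^4" where
  "n2 u v = deriv f u *\<^sub>R curve_c e \<phi> v - (\<epsilon> / (2 * deriv f u)) *\<^sub>R xi1 e"

lemma open_intervals: "open I" "open J" "open (I \<times> J)"
  using intervals by (auto simp: open_interval_def open_Times)

lemma f'_nonzero: "u \<in> I \<Longrightarrow> deriv f u \<noteq> 0"
  using normalization by fastforce

lemma eps_mult [simp]: "\<epsilon> * \<epsilon> = 1" "\<epsilon> * (\<epsilon> * x) = x" "\<epsilon> \<noteq> 0"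
  using eps by auto

lemma g': "u \<in> I \<Longrightarrow> deriv g u = \<epsilon> / (2 * deriv f u)"
  using normalization[of u] f'_nonzero[of u] eps by (auto simp: field_simps)

lemma speed_sq_pos: "v \<in> J \<Longrightarrow> \<epsilon> * speed_sq v > 0" and speed_sq_nonzero: "v \<in> J \<Longrightarrow> speed_sq v \<noteq> 0"
  using lorentz[of v] by (auto simp: speed_sq_def)

lemma gram:
  "ip (ea v) (ea v) = 1" "ip (eb v) (eb v) = -1" "ip (ea v) (eb v) = 0" "ip (eb v) (ea v) = 0"
  "ip (ea v) (xi1 e) = 0" "ip (eb v) (xi1 e) = 0" "ip (ea v) (xi2 e) = 0" "ip (eb v) (xi2 e) = 0"
  "ip (xi1 e) (ea v) = 0" "ip (xi1 e) (eb v) = 0" "ip (xi2 e) (ea v) = 0" "ip (xi2 e) (eb v) = 0"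
  "ip (xi1 e) (xi1 e) = 0" "ip (xi2 e) (xi2 e) = 0" "ip (xi1 e) (xi2 e) = -1"
  "ip (xi2 e) (xi1 e) = -1"
  using basis hyperbolic_pythagoras[of v]
  by (auto simp: pseudo_orthonormal_def ea_def eb_def xi1_def xi2_def ip_simps
      algebra_simps power2_eq_square)

lemma l_eq: "curve_c e \<phi> v = \<phi> v *\<^sub>R ea v + ((\<phi> v)\<^sup>2 / 2) *\<^sub>R xi1 e + xi2 e"
  by (simp add: curve_c_def ea_def algebra_simps)

lemma gram_curve:
  "ip (curve_c e \<phi> v) (curve_c e \<phi> v) = 0" "ip (curve_c e \<phi> v) (xi1 e) = -1"
  "ip (xi1 e) (curve_c e \<phi> v) = -1"
  "ip (curve_c e \<phi> v) (velocity v) = 0" "ip (velocity v) (curve_c e \<phi> v) = 0"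
  "ip (velocity v) (xi1 e) = 0" "ip (xi1 e) (velocity v) = 0"
  "ip (velocity v) (velocity v) = speed_sq v"
  "ip (curve_c e \<phi> v) (n1 v) = 0" "ip (n1 v) (curve_c e \<phi> v) = 0"
  "ip (n1 v) (xi1 e) = 0" "ip (xi1 e) (n1 v) = 0"
  "ip (velocity v) (n1 v) = 0" "ip (n1 v) (velocity v) = 0"
  by (simp_all add: l_eq velocity_def n1_def speed_sq_def ip_simps gram power2_eq_square algebra_simps)

lemma gram_n1: assumes "v \<in> J" shows "ip (n1 v) (n1 v) = - \<epsilon>"
proof -
  have "ip (n1 v) (n1 v) = ((\<epsilon> * speed_sq v) powr (-1/2))\<^sup>2 * (- speed_sq v)"
    by (simp add: n1_def speed_sq_def ip_simps gram power2_eq_square algebra_simps)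
  also have "((\<epsilon> * speed_sq v) powr (-1/2))\<^sup>2 = (\<epsilon> * speed_sq v) powr (-1)"
    by (simp add: power2_eq_square flip: powr_add)
  also have "\<dots> = \<epsilon> / speed_sq v"
    using speed_sq_pos[OF assms] eps by (auto simp: powr_minus divide_simps)
  finally show ?thesis using speed_sq_nonzero[OF assms] by simp
qed

lemma gram_frame:
  assumes "u \<in> I" "v \<in> J"
  shows "ip (zu u v) (zu u v) = - \<epsilon>" "ip (zu u v) (zv u v) = 0" "ip (zv u v) (zu u v) = 0"
    "ip (zv u v) (zv u v) = (f u)\<^sup>2 * speed_sq v"
    "ip (zu u v) (n1 v) = 0" "ip (zv u v) (n1 v) = 0" "ip (zu u v) (n2 u v) = 0"
    "ip (zv u v) (n2 u v) = 0"
    "ip (n1 v) (n1 v) = - \<epsilon>" "ip (n1 v) (n2 u v) = 0" "ip (n2 u v) (n1 v) = 0"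
    "ip (n2 u v) (n2 u v) = \<epsilon>"
  using f'_nonzero[OF assms(1)] gram_n1[OF assms(2)]
  by (simp_all add: zu_def zv_def n2_def ip_simps gram gram_curve power2_eq_square)

lemma derivs_f:
  assumes "u \<in> I"
  shows "(f has_real_derivative deriv f u) (at u)"
    "(deriv f has_real_derivative deriv (deriv f) u) (at u)"
    "(g has_real_derivative \<epsilon> / (2 * deriv f u)) (at u)"
    "((\<lambda>u. \<epsilon> / (2 * deriv f u)) has_real_derivative
        - (\<epsilon> * deriv (deriv f) u / (2 * (deriv f u)\<^sup>2))) (at u)"
proof -
  note * = smooth_on_deriv[OF open_intervals(1)]
  show "(f has_real_derivative deriv f u) (at u)"
    and f2: "(deriv f has_real_derivative deriv (deriv f) u) (at u)"
    and "(g has_real_derivative \<epsilon> / (2 * deriv f u)) (at u)"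
    using smooth smooth_on_has_real_derivative[OF _ assms] * g'[OF assms] by metis+
  show "((\<lambda>u. \<epsilon> / (2 * deriv f u)) has_real_derivative
      - (\<epsilon> * deriv (deriv f) u / (2 * (deriv f u)\<^sup>2))) (at u)"
    using f'_nonzero[OF assms]
    by (auto intro!: derivative_eq_intros f2 simp: field_simps power2_eq_square)
qed

lemma derivs_phi:
  assumes "v \<in> J"
  shows "(\<phi> has_real_derivative deriv \<phi> v) (at v)"
    "(deriv \<phi> has_real_derivative deriv (deriv \<phi>) v) (at v)"
  using smooth(3) smooth_on_has_real_derivative[OF _ assms] smooth_on_deriv[OF open_intervals(2)]
  by metis+

lemma derivs_ea:
  "(ea has_vector_derivative eb v) (at v)" "(eb has_vector_derivative ea v) (at v)"
  unfolding ea_def[abs_def] eb_def[abs_def]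
  by (auto intro!: derivative_eq_intros has_vector_derivative_scaleR)

lemma deriv_curve:
  assumes "v \<in> J"
  shows "(curve_c e \<phi> has_vector_derivative velocity v) (at v)"
proof -
  have "((\<lambda>v. \<phi> v *\<^sub>R ea v + ((\<phi> v)\<^sup>2 / 2) *\<^sub>R xi1 e + xi2 e) has_vector_derivative
     (\<phi> v *\<^sub>R eb v + deriv \<phi> v *\<^sub>R ea v + (((\<phi> v)\<^sup>2 / 2) *\<^sub>R 0 + (\<phi> v * deriv \<phi> v) *\<^sub>R xi1 e)) + 0) (at v)"
    by (intro has_vector_derivative_add has_vector_derivative_scaleR derivs_phi[OF assms] derivs_ea
        has_vector_derivative_const)
      (auto intro!: derivative_eq_intros derivs_phi[OF assms])
  then show ?thesis
    by (simp add: l_eq[abs_def] velocity_def add_ac)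
qed

lemma smooth_on_phi:
  "smooth_on J \<phi>" "smooth_on J (deriv \<phi>)" "smooth_on J (deriv (deriv \<phi>))"
  using smooth(3) smooth_on_deriv[OF open_intervals(2)] by auto

lemma smooth_on_kappa: "smooth_on J \<kappa>"
proof (rule smooth_on_cong[OF open_intervals(2)])
  show "smooth_on J (\<lambda>v. (\<phi> v * deriv (deriv \<phi>) v - 2 * (deriv \<phi> v)\<^sup>2 + (\<phi> v)\<^sup>2)
      * (\<epsilon> * ((deriv \<phi> v)\<^sup>2 - (\<phi> v)\<^sup>2)) powr (-(3/2)))"
    by (intro smooth_on_mult smooth_on_add smooth_on_diff smooth_on_power2 smooth_on_powr
        smooth_on_const smooth_on_phi open_intervals lorentz)
qed (simp only: curvature_c_def powr_minus divide_inverse)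

text \<open>
  The exponents \<open>-3/2\<close> and \<open>-1/2\<close> add up to \<open>-2\<close>, and the square removes the sign \<open>\<epsilon>\<close>.
\<close>

lemma kappa_n1:
  assumes "v \<in> J"
  shows "\<kappa> v * speed_sq v * (\<epsilon> * speed_sq v) powr (-1/2) = curvature_numerator v / speed_sq v"
proof -
  have kappa: "\<kappa> v = curvature_numerator v * (\<epsilon> * speed_sq v) powr (-(3/2))"
    unfolding curvature_c_def curvature_numerator_def speed_sq_def powr_minus by (simp only: divide_inverse)
  have powr: "(\<epsilon> * speed_sq v) powr (-(3/2)) * (\<epsilon> * speed_sq v) powr (-1/2) = 1 / (speed_sq v)\<^sup>2"
  proof -
    have "(\<epsilon> * speed_sq v) powr (-(3/2)) * (\<epsilon> * speed_sq v) powr (-1/2) = (\<epsilon> * speed_sq v) powr (- 2)"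
      by (simp flip: powr_add)
    also have "\<dots> = 1 / (\<epsilon> * speed_sq v)\<^sup>2"
      using speed_sq_pos[OF assms] by (simp add: powr_minus_divide)
    also have "\<dots> = 1 / (speed_sq v)\<^sup>2" using eps by auto
    finally show ?thesis .
  qed
  have "\<kappa> v * speed_sq v * (\<epsilon> * speed_sq v) powr (-1/2)
      = curvature_numerator v * speed_sq v * ((\<epsilon> * speed_sq v) powr (-(3/2)) * (\<epsilon> * speed_sq v) powr (-1/2))"
    unfolding kappa by (simp only: mult_ac)
  also have "\<dots> = curvature_numerator v * speed_sq v * (1 / (speed_sq v)\<^sup>2)" unfolding powr ..
  finally show ?thesis using speed_sq_nonzero[OF assms] by (simp add: power2_eq_square)
qed

text \<open>
  The second derivative of the curve is expanded along its frame by comparing the coefficients of \<open>ea\<close>,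
  \<open>eb\<close> and \<open>xi1\<close>. Its component along \<open>n1\<close> is where the curvature of the curve enters the second
  fundamental form of the surface.
\<close>

lemma deriv_velocity:
  assumes "v \<in> J"
  shows "(velocity has_vector_derivative
    (deriv \<phi> v * (deriv (deriv \<phi>) v - \<phi> v) / speed_sq v) *\<^sub>R velocity v + speed_sq v *\<^sub>R xi1 e
      - (\<kappa> v * speed_sq v) *\<^sub>R n1 v) (at v)"
proof -
  define c x y y' where "c = deriv \<phi> v * (deriv (deriv \<phi>) v - \<phi> v) / speed_sq v"
    and "x = \<phi> v" and "y = deriv \<phi> v" and "y' = deriv (deriv \<phi>) v"
  have D: "((\<lambda>v. deriv \<phi> v *\<^sub>R ea v + \<phi> v *\<^sub>R eb v + (\<phi> v * deriv \<phi> v) *\<^sub>R xi1 e) has_vector_derivative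
      (y *\<^sub>R eb v + y' *\<^sub>R ea v + (x *\<^sub>R ea v + y *\<^sub>R eb v)
        + ((x * y) *\<^sub>R 0 + (x * y' + y * y) *\<^sub>R xi1 e))) (at v)"
    unfolding x_def y_def y'_def
    by (intro has_vector_derivative_add has_vector_derivative_scaleR derivs_phi[OF assms] derivs_ea
        has_vector_derivative_const)
      (auto intro!: derivative_eq_intros derivs_phi[OF assms])
  have coeffs: "c * y - curvature_numerator v / speed_sq v * x = y' + x" "c * x - curvature_numerator v / speed_sq v * y = y + y"
    "c * (x * y) + speed_sq v - curvature_numerator v / speed_sq v * x\<^sup>2 = x * y' + y * y"
  proof -
    have "c * speed_sq v = y * (y' - x)" "curvature_numerator v / speed_sq v * speed_sq v = x * y' - 2 * y\<^sup>2 + x\<^sup>2" "speed_sq v = y\<^sup>2 - x\<^sup>2"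
      using speed_sq_nonzero[OF assms] by (simp_all add: c_def curvature_numerator_def speed_sq_def x_def y_def y'_def)
    then have "(c * y - curvature_numerator v / speed_sq v * x) * speed_sq v = (y' + x) * speed_sq v"
      "(c * x - curvature_numerator v / speed_sq v * y) * speed_sq v = (y + y) * speed_sq v"
      "(c * (x * y) + speed_sq v - curvature_numerator v / speed_sq v * x\<^sup>2) * speed_sq v = (x * y' + y * y) * speed_sq v"
      by algebra+
    then show "c * y - curvature_numerator v / speed_sq v * x = y' + x" "c * x - curvature_numerator v / speed_sq v * y = y + y"
      "c * (x * y) + speed_sq v - curvature_numerator v / speed_sq v * x\<^sup>2 = x * y' + y * y"
      using speed_sq_nonzero[OF assms] by simp_all
  qed
  have "c *\<^sub>R velocity v + speed_sq v *\<^sub>R xi1 e - (curvature_numerator v / speed_sq v) *\<^sub>R (x *\<^sub>R ea v + y *\<^sub>R eb v + x\<^sup>2 *\<^sub>R xi1 e)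
      = (y' + x) *\<^sub>R ea v + (y + y) *\<^sub>R eb v + (x * y' + y * y) *\<^sub>R xi1 e"
    unfolding coeffs[symmetric] by (simp add: velocity_def scaleR_add_right scaleR_add_left scaleR_diff_left
        flip: x_def y_def)
  also have "\<dots> = y *\<^sub>R eb v + y' *\<^sub>R ea v + (x *\<^sub>R ea v + y *\<^sub>R eb v)
        + ((x * y) *\<^sub>R 0 + (x * y' + y * y) *\<^sub>R xi1 e)"
    by (simp only: scaleR_add_left scaleR_zero_right add_0_left add_ac)
  finally have "c *\<^sub>R velocity v + speed_sq v *\<^sub>R xi1 e - (\<kappa> v * speed_sq v) *\<^sub>R n1 v = \<dots>"
    using kappa_n1[OF assms] by (simp add: n1_def x_def y_def)
  with D show ?thesis by (simp only: c_def velocity_def[abs_def])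
qed

text \<open>
  The derivative of \<open>n1\<close> is orthogonal to \<open>n1\<close>, to \<open>xi1\<close> and to the position vector, hence a multiple of
  the velocity.
\<close>

lemma deriv_n1:
  assumes "v \<in> J"
  shows "\<exists>c. (n1 has_vector_derivative c *\<^sub>R velocity v) (at v)"
proof -
  have double: "2 * a = 2 *\<^sub>R a" for a :: "real^4"
    unfolding mult_2 scaleR_2 ..
  define x y y' s where "x = \<phi> v" and "y = deriv \<phi> v" and "y' = deriv (deriv \<phi>) v"
    and "s = (\<epsilon> * speed_sq v) powr (-1/2)"
  have s: "((\<lambda>v. (\<epsilon> * speed_sq v) powr (-1/2)) has_real_derivative - (y * (y' - x) / speed_sq v) * s) (at v)"
  proof -
    have d: "((\<lambda>v. \<epsilon> * speed_sq v) has_real_derivative \<epsilon> * (2 * y * (y' - x))) (at v)"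
      unfolding speed_sq_def[abs_def] x_def y_def y'_def
      by (auto intro!: derivative_eq_intros derivs_phi[OF assms] simp: algebra_simps)
    have "(\<epsilon> * speed_sq v) powr (-1/2 - 1) = s / (\<epsilon> * speed_sq v)"
      using speed_sq_pos[OF assms] by (simp only: s_def powr_diff powr_one)
    then have "((\<lambda>v. (\<epsilon> * speed_sq v) powr (-1/2)) has_real_derivative
        (-1/2) * (s / (\<epsilon> * speed_sq v)) * (\<epsilon> * (2 * y * (y' - x)))) (at v)"
      using DERIV_chain2[OF has_real_derivative_powr[OF speed_sq_pos[OF assms], of "-1/2"] d] by (simp only:)
    then show ?thesis by (rule back_subst) (use speed_sq_nonzero[OF assms] in \<open>simp add: field_simps\<close>)
  qed
  have D: "((\<lambda>v. (\<epsilon> * speed_sq v) powr (-1/2) *\<^sub>R (\<phi> v *\<^sub>R ea v + deriv \<phi> v *\<^sub>R eb v + (\<phi> v)\<^sup>2 *\<^sub>R xi1 e))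
      has_vector_derivative
      (s *\<^sub>R (x *\<^sub>R eb v + y *\<^sub>R ea v + (y *\<^sub>R ea v + y' *\<^sub>R eb v)
        + (x\<^sup>2 *\<^sub>R 0 + (2 * x * y) *\<^sub>R xi1 e))
      + (- (y * (y' - x) / speed_sq v) * s) *\<^sub>R (x *\<^sub>R ea v + y *\<^sub>R eb v + x\<^sup>2 *\<^sub>R xi1 e))) (at v)"
    unfolding x_def y_def y'_def s_def
    by (intro has_vector_derivative_add has_vector_derivative_scaleR derivs_phi[OF assms] derivs_ea
        has_vector_derivative_const s[unfolded x_def y_def y'_def s_def])
      (auto intro!: derivative_eq_intros derivs_phi[OF assms])
  have "y + y - (y * (y' - x) / speed_sq v) * x = - (curvature_numerator v / speed_sq v) * y"
    "x + y' - (y * (y' - x) / speed_sq v) * y = - (curvature_numerator v / speed_sq v) * x"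
    "2 * x * y - (y * (y' - x) / speed_sq v) * x\<^sup>2 = - (curvature_numerator v / speed_sq v) * (x * y)"
  proof -
    define c where "c = y * (y' - x) / speed_sq v"
    have "c * speed_sq v = y * (y' - x)" "curvature_numerator v / speed_sq v * speed_sq v = x * y' - 2 * y\<^sup>2 + x\<^sup>2" "speed_sq v = y\<^sup>2 - x\<^sup>2"
      using speed_sq_nonzero[OF assms] by (simp_all add: c_def curvature_numerator_def speed_sq_def x_def y_def y'_def)
    then have "(y + y - c * x) * speed_sq v = - (curvature_numerator v / speed_sq v) * y * speed_sq v"
      "(x + y' - c * y) * speed_sq v = - (curvature_numerator v / speed_sq v) * x * speed_sq v"
      "(2 * x * y - c * x\<^sup>2) * speed_sq v = - (curvature_numerator v / speed_sq v) * (x * y) * speed_sq v"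
      by algebra+
    then show "y + y - (y * (y' - x) / speed_sq v) * x = - (curvature_numerator v / speed_sq v) * y"
      "x + y' - (y * (y' - x) / speed_sq v) * y = - (curvature_numerator v / speed_sq v) * x"
      "2 * x * y - (y * (y' - x) / speed_sq v) * x\<^sup>2 = - (curvature_numerator v / speed_sq v) * (x * y)"
      unfolding c_def[symmetric] using mult_right_cancel[OF speed_sq_nonzero[OF assms]] by blast+
  qed
  then have velocity: "(y + y - (y * (y' - x) / speed_sq v) * x) *\<^sub>R ea v + (x + y' - (y * (y' - x) / speed_sq v) * y) *\<^sub>R eb v
      + (2 * x * y - (y * (y' - x) / speed_sq v) * x\<^sup>2) *\<^sub>R xi1 e = (- (curvature_numerator v / speed_sq v)) *\<^sub>R velocity v"
    by (simp add: velocity_def scaleR_add_right flip: x_def y_def)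
  (* For c = y * (y' - x) / speed_sq v this is the derivative D, with the coefficients collected. *)
  have combine: "s *\<^sub>R (x *\<^sub>R eb v + y *\<^sub>R ea v + (y *\<^sub>R ea v + y' *\<^sub>R eb v)
        + (x\<^sup>2 *\<^sub>R 0 + (2 * x * y) *\<^sub>R xi1 e)) + (- c * s) *\<^sub>R (x *\<^sub>R ea v + y *\<^sub>R eb v + x\<^sup>2 *\<^sub>R xi1 e)
      = s *\<^sub>R ((y + y - c * x) *\<^sub>R ea v + (x + y' - c * y) *\<^sub>R eb v
          + (2 * x * y - c * x\<^sup>2) *\<^sub>R xi1 e)" for c
    by (simp add: scaleR_add_right scaleR_add_left scaleR_diff_left scaleR_diff_right mult_ac double)
  show ?thesis
    using D unfolding combine velocity scaleR_scaleR n1_def[abs_def, symmetric] by blast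
qed

section \<open>The second fundamental form and the normal connection\<close>

text \<open>
  The derivative of \<open>f f'\<close> with respect to \<open>f\<close>. Up to the sign \<open>\<epsilon>\<close> it is the \<open>n2\<close>-component of the
  mean curvature vector, in the scale in which the \<open>n1\<close>-component is \<open>\<kappa>\<close>.
\<close>

definition M :: "real \<Rightarrow> real" where
  "M u = (f u * deriv (deriv f) u + (deriv f u)\<^sup>2) / deriv f u"

definition W :: "real \<Rightarrow> real \<Rightarrow> real \<times> real \<Rightarrow> real^4" where
  "W x y p = x *\<^sub>R n1 (snd p) + y *\<^sub>R n2 (fst p) (snd p)"

lemma derivative_z:
  assumes "u \<in> I" "v \<in> J"
  shows "(z has_derivative (\<lambda>a. fst a *\<^sub>R zu u v + snd a *\<^sub>R zv u v)) (at (u, v))"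
proof -
  have "((\<lambda>p. f (fst p) *\<^sub>R curve_c e \<phi> (snd p) + g (fst p) *\<^sub>R xi1 e) has_derivative
     (\<lambda>a. ((fst a * deriv f u) *\<^sub>R curve_c e \<phi> v + (snd a * f u) *\<^sub>R velocity v)
       + ((fst a * (\<epsilon> / (2 * deriv f u))) *\<^sub>R xi1 e + (snd a * g u) *\<^sub>R 0))) (at (u, v))"
    by (intro has_derivative_add has_derivative_field derivs_f[OF assms(1)] deriv_curve[OF assms(2)]
        has_vector_derivative_const)
  then show ?thesis
    by (simp add: meridian_surface_def case_prod_unfold zu_def zv_def algebra_simps)
qed

lemma D_flat_z: "u \<in> I \<Longrightarrow> v \<in> J \<Longrightarrow> D_flat a z (u, v) = fst a *\<^sub>R zu u v + snd a *\<^sub>R zv u v"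
  using D_flat_eqI[OF derivative_z] by simp

lemma derivative_zu:
  assumes "u \<in> I" "v \<in> J"
  shows "((\<lambda>p. zu (fst p) (snd p)) has_derivative
    (\<lambda>a. (fst a * (deriv (deriv f) u / deriv f u)) *\<^sub>R n2 u v
       + (snd a * (deriv f u / f u)) *\<^sub>R zv u v)) (at (u, v))"
proof -
  have "((\<lambda>p. deriv f (fst p) *\<^sub>R curve_c e \<phi> (snd p) + (\<epsilon> / (2 * deriv f (fst p))) *\<^sub>R xi1 e)
    has_derivative
     (\<lambda>a. ((fst a * deriv (deriv f) u) *\<^sub>R curve_c e \<phi> v + (snd a * deriv f u) *\<^sub>R velocity v)
       + ((fst a * (- (\<epsilon> * deriv (deriv f) u / (2 * (deriv f u)\<^sup>2)))) *\<^sub>R xi1 e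
         + (snd a * (\<epsilon> / (2 * deriv f u))) *\<^sub>R 0))) (at (u, v))"
    by (intro has_derivative_add has_derivative_field[where x = "\<lambda>u. \<epsilon> / (2 * deriv f u)"]
        has_derivative_field[where x = "deriv f"]
        derivs_f[OF assms(1)] deriv_curve[OF assms(2)] has_vector_derivative_const)
  then show ?thesis
    unfolding zu_def
    by (rule has_derivative_eq_rhs)
      (use f'_nonzero[OF assms(1)] f_pos[OF assms(1)] in
        \<open>simp add: fun_eq_iff n2_def zv_def scaleR_diff_right power2_eq_square mult_ac\<close>)
qed

lemma derivative_n2:
  assumes "u \<in> I" "v \<in> J"
  shows "((\<lambda>p. n2 (fst p) (snd p)) has_derivative
    (\<lambda>a. (fst a * (deriv (deriv f) u / deriv f u)) *\<^sub>R zu u v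
       + (snd a * (deriv f u / f u)) *\<^sub>R zv u v)) (at (u, v))"
proof -
  have "((\<lambda>p. deriv f (fst p) *\<^sub>R curve_c e \<phi> (snd p) - (\<epsilon> / (2 * deriv f (fst p))) *\<^sub>R xi1 e)
    has_derivative
     (\<lambda>a. ((fst a * deriv (deriv f) u) *\<^sub>R curve_c e \<phi> v + (snd a * deriv f u) *\<^sub>R velocity v)
       - ((fst a * (- (\<epsilon> * deriv (deriv f) u / (2 * (deriv f u)\<^sup>2)))) *\<^sub>R xi1 e
         + (snd a * (\<epsilon> / (2 * deriv f u))) *\<^sub>R 0))) (at (u, v))"
    by (intro has_derivative_diff has_derivative_field[where x = "\<lambda>u. \<epsilon> / (2 * deriv f u)"]
        has_derivative_field[where x = "deriv f"]
        derivs_f[OF assms(1)] deriv_curve[OF assms(2)] has_vector_derivative_const)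
  then show ?thesis
    unfolding n2_def
    by (rule has_derivative_eq_rhs)
      (use f'_nonzero[OF assms(1)] f_pos[OF assms(1)] in
        \<open>simp add: fun_eq_iff zu_def zv_def scaleR_add_right power2_eq_square mult_ac\<close>)
qed

text \<open>
  The \<open>xi1\<close>-component of the acceleration of the curve splits into a tangent part along \<open>zu\<close> and
  a normal part along \<open>n2\<close>, because \<open>zu - n2\<close> is a multiple of \<open>xi1\<close>.
\<close>

lemma derivative_zv:
  assumes "u \<in> I" "v \<in> J"
  shows "\<exists>c. ((\<lambda>p. zv (fst p) (snd p)) has_derivative
    (\<lambda>a. (fst a * (deriv f u / f u)) *\<^sub>R zv u v
       + snd a *\<^sub>R (c *\<^sub>R zv u v + (\<epsilon> * f u * deriv f u * speed_sq v) *\<^sub>R zu u v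
           + ((- f u * \<kappa> v * speed_sq v) *\<^sub>R n1 v + (- \<epsilon> * f u * deriv f u * speed_sq v) *\<^sub>R n2 u v)))) (at (u, v))"
proof -
  define c where "c = deriv \<phi> v * (deriv (deriv \<phi>) v - \<phi> v) / speed_sq v"
  have xi: "xi1 e = (\<epsilon> * deriv f u) *\<^sub>R (zu u v - n2 u v)"
    using f'_nonzero[OF assms(1)]
    by (simp add: zu_def n2_def algebra_simps flip: scaleR_add_left)
  have "((\<lambda>p. f (fst p) *\<^sub>R velocity (snd p)) has_derivative
     (\<lambda>a. (fst a * deriv f u) *\<^sub>R velocity v
       + (snd a * f u) *\<^sub>R (c *\<^sub>R velocity v + speed_sq v *\<^sub>R xi1 e - (\<kappa> v * speed_sq v) *\<^sub>R n1 v))) (at (u, v))"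
    unfolding c_def
    by (intro has_derivative_field derivs_f[OF assms(1)] deriv_velocity[OF assms(2)])
  moreover have "(\<lambda>a. (fst a * deriv f u) *\<^sub>R velocity v
       + (snd a * f u) *\<^sub>R (c *\<^sub>R velocity v + speed_sq v *\<^sub>R xi1 e - (\<kappa> v * speed_sq v) *\<^sub>R n1 v))
    = (\<lambda>a. (fst a * (deriv f u / f u)) *\<^sub>R zv u v
       + snd a *\<^sub>R (c *\<^sub>R zv u v + (\<epsilon> * f u * deriv f u * speed_sq v) *\<^sub>R zu u v
           + ((- f u * \<kappa> v * speed_sq v) *\<^sub>R n1 v + (- \<epsilon> * f u * deriv f u * speed_sq v) *\<^sub>R n2 u v)))"
    using f_pos[OF assms(1)] unfolding xi by (simp add: fun_eq_iff zv_def algebra_simps)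
  ultimately show ?thesis unfolding zv_def by auto
qed

lemma tangent_iff:
  assumes "u \<in> I" "v \<in> J"
  shows "t \<in> tangent_space z (u, v) \<longleftrightarrow> (\<exists>a b. t = a *\<^sub>R zu u v + b *\<^sub>R zv u v)"
proof
  assume "\<exists>a b. t = a *\<^sub>R zu u v + b *\<^sub>R zv u v"
  then obtain a b where "t = D_flat (a, b) z (u, v)" using D_flat_z[OF assms] by auto
  then show "t \<in> tangent_space z (u, v)" by (auto simp: tangent_space_def)
qed (auto simp: tangent_space_def D_flat_z[OF assms])

lemma normal_iff:
  assumes "u \<in> I" "v \<in> J"
  shows "n \<in> normal_space z (u, v) \<longleftrightarrow> ip (zu u v) n = 0 \<and> ip (zv u v) n = 0"
proof
  assume "n \<in> normal_space z (u, v)"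
  then have "ip (a *\<^sub>R zu u v + b *\<^sub>R zv u v) n = 0" for a b
    using tangent_iff[OF assms] by (auto simp: normal_space_def)
  from this[of 1 0] this[of 0 1] show "ip (zu u v) n = 0 \<and> ip (zv u v) n = 0" by simp
qed (auto simp: normal_space_def tangent_iff[OF assms] ip_simps)

text \<open>The tangent plane is nondegenerate, so the decomposition of a vector is unique.\<close>

lemma normal_part_eqI:
  assumes "u \<in> I" "v \<in> J"
    and n: "n \<in> normal_space z (u, v)" and t: "x - n \<in> tangent_space z (u, v)"
  shows "normal_part z (u, v) x = n"
  unfolding normal_part_def
proof (rule the_equality)
  fix m assume m: "m \<in> normal_space z (u, v) \<and> x - m \<in> tangent_space z (u, v)"
  obtain a b where 1: "x - n = a *\<^sub>R zu u v + b *\<^sub>R zv u v"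
    using t tangent_iff[OF assms(1,2)] by blast
  obtain a' b' where 2: "x - m = a' *\<^sub>R zu u v + b' *\<^sub>R zv u v"
    using m tangent_iff[OF assms(1,2)] by blast
  have d: "m - n = (a - a') *\<^sub>R zu u v + (b - b') *\<^sub>R zv u v"
  proof -
    have "m - n = (x - n) - (x - m)" by simp
    also have "\<dots> = (a - a') *\<^sub>R zu u v + (b - b') *\<^sub>R zv u v"
      unfolding 1 2 by (simp add: algebra_simps)
    finally show ?thesis .
  qed
  have "ip (zu u v) (m - n) = 0" "ip (zv u v) (m - n) = 0"
    using m n normal_iff[OF assms(1,2)] by (auto simp: ip_simps)
  then have "a - a' = 0" "b - b' = 0"
    unfolding d using f_pos[OF assms(1)] speed_sq_nonzero[OF assms(2)]
    by (auto simp: ip_simps gram_frame[OF assms(1,2)])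
  then show "m = n" using d by simp
qed (use n t in blast)

lemma normal_part_frame:
  assumes "u \<in> I" "v \<in> J"
  shows "normal_part z (u, v)
    (a *\<^sub>R zv u v + b *\<^sub>R zu u v + (x *\<^sub>R n1 v + y *\<^sub>R n2 u v)) = x *\<^sub>R n1 v + y *\<^sub>R n2 u v"
proof (rule normal_part_eqI[OF assms])
  show "x *\<^sub>R n1 v + y *\<^sub>R n2 u v \<in> normal_space z (u, v)"
    by (simp add: normal_iff[OF assms] ip_simps gram_frame[OF assms])
  show "a *\<^sub>R zv u v + b *\<^sub>R zu u v + (x *\<^sub>R n1 v + y *\<^sub>R n2 u v) - (x *\<^sub>R n1 v + y *\<^sub>R n2 u v)
      \<in> tangent_space z (u, v)"
    unfolding tangent_iff[OF assms] by (intro exI[of _ b] exI[of _ a]) simp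
qed

text \<open>
  Normal vectors do not see tangent parts. So the vanishing of a normal part can be used in inner
  products, without expanding the vector along the frame.
\<close>

lemma ip_normal_part:
  assumes "u \<in> I" "v \<in> J" and n: "n \<in> normal_space z (u, v)"
  shows "ip (normal_part z (u, v) x) n = ip x n"
proof -
  define t where "t = (ip (zu u v) x / (-\<epsilon>)) *\<^sub>R zu u v
      + (ip (zv u v) x / ((f u)\<^sup>2 * speed_sq v)) *\<^sub>R zv u v"
  have "x - t \<in> normal_space z (u, v)"
    using f_pos[OF assms(1)] speed_sq_nonzero[OF assms(2)]
    by (simp add: normal_iff[OF assms(1,2)] t_def ip_simps gram_frame[OF assms(1,2)])
  moreover have "x - (x - t) \<in> tangent_space z (u, v)"
    unfolding tangent_iff[OF assms(1,2)] t_def diff_diff_eq2 add_diff_cancel_left' by blast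
  ultimately have "normal_part z (u, v) x = x - t"
    by (rule normal_part_eqI[OF assms(1,2)])
  moreover have "ip t n = 0"
    using n by (simp add: t_def normal_iff[OF assms(1,2)] ip_simps)
  ultimately show ?thesis by (simp add: ip_simps)
qed

lemma D_flat_cong:
  assumes "u \<in> I" "v \<in> J" "\<And>u v. u \<in> I \<Longrightarrow> v \<in> J \<Longrightarrow> F (u, v) = G (u, v)"
    and "(G has_derivative G') (at (u, v))"
  shows "D_flat a F (u, v) = G' a"
proof (rule D_flat_eqI, rule has_derivative_transform_within_open[OF assms(4) open_intervals(3)])
  show "G p = F p" if "p \<in> I \<times> J" for p using that assms(3) by (cases p) auto
qed (use assms(1,2) in auto)

lemma second_form_eq:
  assumes "u \<in> I" "v \<in> J"
  shows "second_form z (u, v) (1, 0) (1, 0) = (deriv (deriv f) u / deriv f u) *\<^sub>R n2 u v"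
    "second_form z (u, v) (0, 1) (0, 1) =
      (- f u * \<kappa> v * speed_sq v) *\<^sub>R n1 v + (- \<epsilon> * f u * deriv f u * speed_sq v) *\<^sub>R n2 u v"
proof -
  have "D_flat (1, 0) (D_flat (1, 0) z) (u, v) = (deriv (deriv f) u / deriv f u) *\<^sub>R n2 u v"
    using D_flat_cong[OF assms _ derivative_zu[OF assms], of "D_flat (1, 0) z"] D_flat_z by simp
  then show "second_form z (u, v) (1, 0) (1, 0) = (deriv (deriv f) u / deriv f u) *\<^sub>R n2 u v"
    using normal_part_frame[OF assms, of 0 0 0] by (simp add: second_form_def)
  obtain c where "((\<lambda>p. zv (fst p) (snd p)) has_derivative
    (\<lambda>a. (fst a * (deriv f u / f u)) *\<^sub>R zv u v
       + snd a *\<^sub>R (c *\<^sub>R zv u v + (\<epsilon> * f u * deriv f u * speed_sq v) *\<^sub>R zu u v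
           + ((- f u * \<kappa> v * speed_sq v) *\<^sub>R n1 v + (- \<epsilon> * f u * deriv f u * speed_sq v) *\<^sub>R n2 u v)))) (at (u, v))"
    using derivative_zv[OF assms] by blast
  from D_flat_cong[OF assms _ this, of "D_flat (0, 1) z" "(0, 1)"] D_flat_z
  have "D_flat (0, 1) (D_flat (0, 1) z) (u, v) =
      c *\<^sub>R zv u v + (\<epsilon> * f u * deriv f u * speed_sq v) *\<^sub>R zu u v
        + ((- f u * \<kappa> v * speed_sq v) *\<^sub>R n1 v + (- \<epsilon> * f u * deriv f u * speed_sq v) *\<^sub>R n2 u v)" by simp
  then show "second_form z (u, v) (0, 1) (0, 1) =
      (- f u * \<kappa> v * speed_sq v) *\<^sub>R n1 v + (- \<epsilon> * f u * deriv f u * speed_sq v) *\<^sub>R n2 u v"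
    unfolding second_form_def by (simp only: normal_part_frame[OF assms])
qed

text \<open>
  Since \<open>E = - \<epsilon>\<close>, \<open>F = 0\<close> and \<open>G = f\<^sup>2 speed_sq\<close>, the mean curvature vector is half the sum of \<open>h(zu,zu)/E\<close>,
  which is along \<open>n2\<close>, and \<open>h(zv,zv)/G\<close>. The two \<open>n2\<close>-components add up to a multiple of \<open>M\<close>.
\<close>

lemma mean_curvature_eq:
  assumes "u \<in> I" "v \<in> J"
  shows "mean_curvature_vector z (u, v) =
    (- (1 / (2 * f u))) *\<^sub>R (\<kappa> v *\<^sub>R n1 v + (\<epsilon> * M u) *\<^sub>R n2 u v)"
proof -
  have ff: "first_form z (u, v) (1, 0) (1, 0) = - \<epsilon>" "first_form z (u, v) (1, 0) (0, 1) = 0"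
    "first_form z (u, v) (0, 1) (0, 1) = (f u)\<^sup>2 * speed_sq v"
    by (simp_all add: first_form_def D_flat_z[OF assms] gram_frame[OF assms])
  have nz: "f u \<noteq> 0" "deriv f u \<noteq> 0" "speed_sq v \<noteq> 0"
    using f_pos[OF assms(1)] f'_nonzero[OF assms(1)] speed_sq_nonzero[OF assms(2)] by auto
  define h where "h = deriv (deriv f) u / deriv f u"
  define D where "D = 1 / 2 * (1 / (- \<epsilon> * ((f u)\<^sup>2 * speed_sq v)))"
  have "mean_curvature_vector z (u, v) = D *\<^sub>R (((f u)\<^sup>2 * speed_sq v) *\<^sub>R (h *\<^sub>R n2 u v)
      + (- \<epsilon>) *\<^sub>R ((- f u * \<kappa> v * speed_sq v) *\<^sub>R n1 v + (- \<epsilon> * f u * deriv f u * speed_sq v) *\<^sub>R n2 u v))"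
    by (simp add: mean_curvature_vector_def Let_def ff second_form_eq[OF assms] h_def D_def)
  also have "\<dots> = (D * \<epsilon> * f u * \<kappa> v * speed_sq v) *\<^sub>R n1 v
      + (D * ((f u)\<^sup>2 * speed_sq v * h + f u * deriv f u * speed_sq v)) *\<^sub>R n2 u v"
    by (simp add: algebra_simps)
  also have "D * \<epsilon> * f u * \<kappa> v * speed_sq v = - (1 / (2 * f u)) * \<kappa> v"
    using nz by (simp add: D_def power2_eq_square)
  also have "D * ((f u)\<^sup>2 * speed_sq v * h + f u * deriv f u * speed_sq v) = - (1 / (2 * f u)) * (\<epsilon> * M u)"
  proof -
    have "(f u)\<^sup>2 * speed_sq v * h + f u * deriv f u * speed_sq v = f u * speed_sq v * M u"
      using nz by (simp add: M_def h_def add_divide_distrib distrib_left power2_eq_square)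
    moreover have "D * (f u * speed_sq v) = - (1 / (2 * f u)) * \<epsilon>"
      using nz eps by (auto simp: D_def power2_eq_square)
    ultimately show ?thesis by (metis mult.assoc)
  qed
  finally show ?thesis by (simp add: scaleR_add_right)
qed

lemma ip_W:
  assumes "u \<in> I" "v \<in> J"
  shows "ip (W x y (u, v)) (W x' y' (u, v)) = \<epsilon> * (y * y' - x * x')"
  by (simp add: W_def ip_simps gram_frame[OF assms] algebra_simps)

lemma W_normal:
  assumes "u \<in> I" "v \<in> J"
  shows "W x y (u, v) \<in> normal_space z (u, v)"
  by (simp add: W_def normal_iff[OF assms] ip_simps gram_frame[OF assms])

text \<open>
  The derivatives of both normals of the frame are tangent, hence so are those of their combinations with
  constant coefficients: the normal bundle is flat.
\<close>

lemma derivative_W: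
  assumes "u \<in> I" "v \<in> J"
  shows "\<exists>W'. (W x y has_derivative W') (at (u, v)) \<and> (\<forall>a. W' a \<in> tangent_space z (u, v))"
proof -
  obtain c where c: "(n1 has_vector_derivative c *\<^sub>R velocity v) (at v)"
    using deriv_n1[OF assms(2)] by blast
  have n1: "((\<lambda>p. n1 (snd p)) has_derivative (\<lambda>a. (snd a * (c / f u)) *\<^sub>R zv u v)) (at (u, v))"
    using has_derivative_field[OF DERIV_const[of 1] c, of u] f_pos[OF assms(1)]
    by (simp add: zv_def)
  have "(W x y has_derivative (\<lambda>a. x *\<^sub>R ((snd a * (c / f u)) *\<^sub>R zv u v)
     + y *\<^sub>R ((fst a * (deriv (deriv f) u / deriv f u)) *\<^sub>R zu u v
       + (snd a * (deriv f u / f u)) *\<^sub>R zv u v))) (at (u, v))"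
    unfolding W_def[abs_def]
    by (intro has_derivative_add has_derivative_scaleR_right n1 derivative_n2[OF assms])
  moreover have "x *\<^sub>R ((snd a * (c / f u)) *\<^sub>R zv u v)
     + y *\<^sub>R ((fst a * (deriv (deriv f) u / deriv f u)) *\<^sub>R zu u v
       + (snd a * (deriv f u / f u)) *\<^sub>R zv u v) \<in> tangent_space z (u, v)" for a
    unfolding tangent_iff[OF assms]
    by (intro exI[of _ "y * (fst a * (deriv (deriv f) u / deriv f u))"]
        exI[of _ "x * (snd a * (c / f u)) + y * (snd a * (deriv f u / f u))"])
      (simp add: scaleR_add_right scaleR_add_left)
  ultimately show ?thesis by blast
qed

lemma zero_normal: "u \<in> I \<Longrightarrow> v \<in> J \<Longrightarrow> 0 \<in> normal_space z (u, v)"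
  by (simp add: normal_iff ip_simps)

lemma parallel_W: "parallel_normal_field (I \<times> J) z (W x y)"
  unfolding parallel_normal_field_def normal_connection_def
proof (clarify, goal_cases)
  case (1 u v a b)
  obtain W' where "(W x y has_derivative W') (at (u, v))" "W' (a, b) \<in> tangent_space z (u, v)"
    using derivative_W[OF 1] by blast
  then show ?case
    using normal_part_eqI[OF 1 zero_normal[OF 1], of "W' (a, b)"] by (simp add: D_flat_eqI)
qed

lemma smooth_on_W: "smooth_on (I \<times> J) (W x y)"
proof -
  note I = open_intervals(1) and J = open_intervals(2)
  have f': "smooth_on I (deriv f)" using smooth_on_deriv[OF I smooth(1)] .
  have a: "smooth_on J ea" "smooth_on J eb"
    unfolding ea_def[abs_def] eb_def[abs_def]
    by (intro smooth_on_add smooth_on_scaleR smooth_on_const smooth_on_cosh_sinh J)+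
  have p: "smooth_on J (\<lambda>v. (\<epsilon> * speed_sq v) powr (-1/2))"
    by (intro smooth_on_powr J speed_sq_pos) (auto simp: speed_sq_def[abs_def] intro!: smooth_on_mult
        smooth_on_const smooth_on_diff smooth_on_power2 smooth_on_phi J)
  have n1: "smooth_on J n1"
    unfolding n1_def[abs_def]
    by (intro smooth_on_scaleR smooth_on_add p a J smooth_on_power2 smooth_on_phi smooth_on_const)
  have "smooth_on J (\<lambda>v. (\<phi> v)\<^sup>2 * (1 / 2))"
    by (intro smooth_on_mult J smooth_on_power2 smooth_on_phi smooth_on_const)
  then have l: "smooth_on J (curve_c e \<phi>)"
    unfolding l_eq[abs_def]
    by (intro smooth_on_add smooth_on_scaleR a J smooth_on_phi smooth_on_const) simp
  have g': "smooth_on I (\<lambda>u. \<epsilon> / (2 * deriv f u))"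
    by (rule smooth_on_cong[OF I smooth_on_deriv[OF I smooth(2)] g'])
  have "smooth_on (I \<times> J) (\<lambda>p. deriv f (fst p) *\<^sub>R curve_c e \<phi> (snd p)
      - (\<epsilon> / (2 * deriv f (fst p))) *\<^sub>R xi1 e)"
    by (intro smooth_on_diff smooth_on_scaleR open_intervals(3) smooth_on_const
        smooth_on_compose_fst[OF I J f'] smooth_on_compose_fst[OF I J g']
        smooth_on_compose_snd[OF I J l])
  then have "smooth_on (I \<times> J) (\<lambda>p. n2 (fst p) (snd p))" unfolding n2_def .
  then show ?thesis
    unfolding W_def[abs_def]
    by (intro smooth_on_add smooth_on_scaleR open_intervals(3) smooth_on_const
        smooth_on_compose_snd[OF I J n1])
qed

section \<open>Parallel normalized mean curvature\<close>

text \<open>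
  The product rule for \<open>\<langle>X, W\<rangle>\<close>: in the first term a normal vector meets the tangent derivative of
  \<open>W\<close>, in the second a normal vector meets a derivative whose normal part vanishes. So the derivative is
  zero, and \<open>I \<times> J\<close> is convex.
\<close>

lemma parallel_ip_W_constant:
  assumes par: "parallel_normal_field (I \<times> J) z X"
    and sm: "smooth_on (I \<times> J) X"
    and X: "\<And>u v. u \<in> I \<Longrightarrow> v \<in> J \<Longrightarrow> X (u, v) \<in> normal_space z (u, v)"
  shows "\<exists>c. \<forall>u\<in>I. \<forall>v\<in>J. ip (X (u, v)) (W x y (u, v)) = c"
proof -
  have "((\<lambda>p. ip (X p) (W x y p)) has_derivative (\<lambda>a. 0)) (at p within I \<times> J)" if p: "p \<in> I \<times> J" for p
  proof -
    obtain u v where uv: "p = (u, v)" "u \<in> I" "v \<in> J" using p by auto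
    obtain W' where W': "(W x y has_derivative W') (at p)" "\<And>a. W' a \<in> tangent_space z p"
      using derivative_W[OF uv(2,3)] uv(1) by blast
    note X' = smooth_on_has_derivative[OF sm p]
    have "ip (X p) (W' a) + ip (frechet_derivative X (at p) a) (W x y p) = 0" for a
    proof -
      have "ip (X p) (W' a) = 0"
        using X[OF uv(2,3)] W'(2)[of a] uv(1) ip_commute by (auto simp: normal_space_def)
      moreover have "normal_part z p (frechet_derivative X (at p) a) = 0"
        using par p unfolding parallel_normal_field_def normal_connection_def D_flat_def by blast
      then have "ip (frechet_derivative X (at p) a) (W x y p) = 0"
        using ip_normal_part[OF uv(2,3) W_normal[OF uv(2,3)]] uv(1) by (metis ip.zero_left)
      ultimately show ?thesis by simp
    qed
    then have "((\<lambda>p. ip (X p) (W x y p)) has_derivative (\<lambda>a. 0)) (at p)"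
      using ip.FDERIV[OF X' W'(1)] by simp
    then show ?thesis by (rule has_derivative_at_withinI)
  qed
  moreover have "convex (I \<times> J)"
    using intervals by (auto simp: open_interval_def is_interval_convex intro!: convex_Times)
  ultimately have "\<exists>c. \<forall>p\<in>I \<times> J. ip (X p) (W x y p) = c"
    by (intro has_derivative_zero_constant)
  then show ?thesis by blast
qed

lemma ip_mean_curvature:
  assumes "u \<in> I" "v \<in> J"
  shows "ip (mean_curvature_vector z (u, v)) (mean_curvature_vector z (u, v)) =
      \<epsilon> * ((M u)\<^sup>2 - (\<kappa> v)\<^sup>2) / (4 * (f u)\<^sup>2)"
proof -
  have "mean_curvature_vector z (u, v) = (- (1 / (2 * f u))) *\<^sub>R W (\<kappa> v) (\<epsilon> * M u) (u, v)"
    by (simp add: mean_curvature_eq[OF assms] W_def)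
  then show ?thesis
    using ip_W[OF assms, of "\<kappa> v" "\<epsilon> * M u" "\<kappa> v" "\<epsilon> * M u"]
    by (simp add: ip_simps power2_eq_square mult_ac)
qed

text \<open>
  The direction of the mean curvature vector in the parallel frame is constant and not null: up to the
  sign \<open>\<epsilon>\<close>, its two coefficients have the constant ratio \<open>\<mu>\<close>.
\<close>

definition ratio :: "real \<Rightarrow> bool" where
  "ratio \<mu> \<longleftrightarrow> (\<forall>v\<in>J. \<kappa> v \<noteq> 0) \<and> \<mu>\<^sup>2 \<noteq> 1 \<and> (\<forall>u\<in>I. \<forall>v\<in>J. M u = \<mu> * \<kappa> v)"

text \<open>
  The parallel unit field is \<open>- R (\<kappa> n1 + \<epsilon> M n2)\<close> with some positive function \<open>R\<close>, and its products
  with \<open>n1\<close> and \<open>n2\<close> are constants \<open>\<alpha>\<close> and \<open>\<beta>\<close>. The first is nonzero because \<open>\<kappa>\<close> is nonzero somewhere;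
  hence \<open>\<kappa>\<close> has no zero, and the unknown \<open>R\<close> cancels from the quotient.
\<close>

lemma parallel_normalized_imp_ratio:
  assumes pn: "parallel_normalized_mean_curvature (I \<times> J) z" and k: "\<exists>v\<in>J. \<kappa> v \<noteq> 0"
  shows "\<exists>\<mu>. ratio \<mu>"
proof -
  let ?H = "mean_curvature_vector z"
  have HH: "\<And>p. p \<in> I \<times> J \<Longrightarrow> ip (?H p) (?H p) \<noteq> 0"
    using pn by (auto simp: parallel_normalized_mean_curvature_def Let_def)
  obtain H0 where H0: "smooth_on (I \<times> J) H0" "\<forall>p\<in>I \<times> J. \<exists>r>0. H0 p = r *\<^sub>R ?H p"
      "parallel_normal_field (I \<times> J) z H0"
    using pn unfolding parallel_normalized_mean_curvature_def Let_def by blast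
  have ex: "\<exists>R>0. H0 (u, v) = (- R) *\<^sub>R W (\<kappa> v) (\<epsilon> * M u) (u, v)" if uv: "u \<in> I" "v \<in> J" for u v
  proof -
    obtain r where r: "r > 0" "H0 (u, v) = r *\<^sub>R ?H (u, v)"
      using bspec[OF H0(2), of "(u, v)"] uv by auto
    show ?thesis
      using r f_pos[OF uv(1)]
      by (intro exI[of _ "r / (2 * f u)"]) (simp add: mean_curvature_eq[OF uv] W_def)
  qed
  (* A pointwise choice suffices: R is going to cancel. *)
  define R where "R u v = (SOME R. R > 0 \<and> H0 (u, v) = (- R) *\<^sub>R W (\<kappa> v) (\<epsilon> * M u) (u, v))" for u v
  have R: "R u v > 0" "H0 (u, v) = (- R u v) *\<^sub>R W (\<kappa> v) (\<epsilon> * M u) (u, v)" if "u \<in> I" "v \<in> J" for u v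
    using someI_ex[OF ex[OF that]] by (auto simp: R_def)
  have normal: "H0 (u, v) \<in> normal_space z (u, v)" if "u \<in> I" "v \<in> J" for u v
    using W_normal[OF that] R(2)[OF that] by (simp add: normal_iff[OF that] ip_simps)
  obtain \<alpha> where "\<forall>u\<in>I. \<forall>v\<in>J. ip (H0 (u, v)) (W 1 0 (u, v)) = \<alpha>"
    using parallel_ip_W_constant[OF H0(3,1) normal, of 1 0] by blast
  then have \<alpha>: "\<epsilon> * R u v * \<kappa> v = \<alpha>" if "u \<in> I" "v \<in> J" for u v
    using that by (auto simp: R ip_simps ip_W mult_ac)
  obtain \<beta> where "\<forall>u\<in>I. \<forall>v\<in>J. ip (H0 (u, v)) (W 0 1 (u, v)) = \<beta>"
    using parallel_ip_W_constant[OF H0(3,1) normal, of 0 1] by blast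
  then have \<beta>: "- R u v * M u = \<beta>" if "u \<in> I" "v \<in> J" for u v
    using that by (auto simp: R ip_simps ip_W mult_ac)
  obtain u0 where u0: "u0 \<in> I" using intervals by (auto simp: open_interval_def)
  obtain v0 where v0: "v0 \<in> J" "\<kappa> v0 \<noteq> 0" using k by blast
  have "\<alpha> \<noteq> 0" using \<alpha>[OF u0 v0(1)] R(1)[OF u0 v0(1)] v0(2) by auto
  have nz: "\<forall>v\<in>J. \<kappa> v \<noteq> 0" using \<alpha>[OF u0] \<open>\<alpha> \<noteq> 0\<close> by force
  have eq: "M u = (- \<beta> * \<epsilon> / \<alpha>) * \<kappa> v" if "u \<in> I" "v \<in> J" for u v
  proof -
    have "R u v * (M u * \<alpha>) = R u v * (- \<beta> * \<epsilon> * \<kappa> v)"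
      by (simp add: \<alpha>[OF that, symmetric] \<beta>[OF that, symmetric] mult_ac)
    then have "M u * \<alpha> = - \<beta> * \<epsilon> * \<kappa> v" 
      by (rule mult_left_cancel[THEN iffD1, rotated]) (use R(1)[OF that] in linarith)
    then show ?thesis using \<open>\<alpha> \<noteq> 0\<close> by (simp add: field_simps)
  qed
  have "(- \<beta> * \<epsilon> / \<alpha>)\<^sup>2 \<noteq> 1"
  proof
    assume "(- \<beta> * \<epsilon> / \<alpha>)\<^sup>2 = 1"
    then have "(M u0)\<^sup>2 = (\<kappa> v0)\<^sup>2"
      unfolding eq[OF u0 v0(1)] power_mult_distrib by simp
    then show False using HH[of "(u0, v0)"] u0 v0(1) by (simp add: ip_mean_curvature)
  qed
  with nz eq show ?thesis unfolding ratio_def by blast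
qed

lemma mean_curvature_ratio:
  assumes "ratio \<mu>" "u \<in> I" "v \<in> J"
  shows "mean_curvature_vector z (u, v) = (- (1 / (2 * f u)) * \<kappa> v) *\<^sub>R W 1 (\<epsilon> * \<mu>) (u, v)"
  using assms by (simp add: mean_curvature_eq W_def ratio_def scaleR_add_right mult_ac)

text \<open>
  The normalized mean curvature vector is a constant multiple of \<open>n1 + \<epsilon> \<mu> n2\<close>. The multiple must have
  the sign of \<open>- \<kappa>\<close>, which is constant because \<open>\<kappa>\<close> has no zero on an interval.
\<close>

lemma ratio_imp_parallel_normalized:
  assumes r: "ratio \<mu>"
  shows "parallel_normalized_mean_curvature (I \<times> J) z"
proof -
  let ?H = "mean_curvature_vector z"
  have nz: "\<And>v. v \<in> J \<Longrightarrow> \<kappa> v \<noteq> 0" and mu: "\<mu>\<^sup>2 \<noteq> 1" using r by (auto simp: ratio_def)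
  obtain v0 where v0: "v0 \<in> J" using intervals by (auto simp: open_interval_def)
  define \<sigma> where "\<sigma> = sgn (\<kappa> v0)"
  have \<sigma>: "\<sigma> * \<kappa> v = \<bar>\<kappa> v\<bar>" if "v \<in> J" for v
  proof -
    have c: "continuous_on J \<kappa>"
      using smooth_on_kappa unfolding smooth_on_def by (metis higher_differentiable_on.simps(1))
    have "connected (\<kappa> ` J)"
      using intervals(2) by (intro connected_continuous_image[OF c])
        (auto simp: open_interval_def is_interval_connected)
    moreover have "0 \<notin> \<kappa> ` J" using nz by auto
    moreover have "\<kappa> v \<in> \<kappa> ` J" "\<kappa> v0 \<in> \<kappa> ` J" using that v0 by auto
    ultimately have "\<not> (\<kappa> v < 0 \<and> 0 < \<kappa> v0)" "\<not> (\<kappa> v0 < 0 \<and> 0 < \<kappa> v)"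
      using connectedD_interval[of "\<kappa> ` J" "\<kappa> v" "\<kappa> v0" 0]
        connectedD_interval[of "\<kappa> ` J" "\<kappa> v0" "\<kappa> v" 0] by auto
    then show ?thesis using nz[OF that] nz[OF v0] by (auto simp: \<sigma>_def sgn_if abs_if)
  qed
  have \<sigma>2: "\<sigma>\<^sup>2 = 1" using nz[OF v0] by (auto simp: \<sigma>_def sgn_if)
  define d where "d = sqrt \<bar>\<mu>\<^sup>2 - 1\<bar>"
  have d: "d > 0" "d\<^sup>2 = \<bar>\<mu>\<^sup>2 - 1\<bar>" using mu by (auto simp: d_def)
  define H0 where "H0 = W (- \<sigma> / d) (- \<sigma> / d * (\<epsilon> * \<mu>))"
  have H0_W: "H0 p = (- \<sigma> / d) *\<^sub>R W 1 (\<epsilon> * \<mu>) p" for p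
    by (simp add: H0_def W_def scaleR_add_right)
  have HH: "?H p \<noteq> 0 \<and> ip (?H p) (?H p) \<noteq> 0" if p: "p \<in> I \<times> J" for p
  proof -
    obtain u v where uv: "p = (u, v)" "u \<in> I" "v \<in> J" using p by auto
    have "(M u)\<^sup>2 - (\<kappa> v)\<^sup>2 = (\<mu>\<^sup>2 - 1) * (\<kappa> v)\<^sup>2"
      using r uv by (simp add: ratio_def power_mult_distrib algebra_simps)
    then have "ip (?H p) (?H p) \<noteq> 0"
      using uv f_pos[of u] nz[of v] mu by (simp add: ip_mean_curvature)
    then show ?thesis by (auto simp: ip_simps)
  qed
  have unit: "ip (H0 p) (H0 p) = 1 \<or> ip (H0 p) (H0 p) = -1" if p: "p \<in> I \<times> J" for p
  proof -
    obtain u v where uv: "p = (u, v)" "u \<in> I" "v \<in> J" using p by auto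
    have "ip (H0 p) (H0 p) = \<sigma>\<^sup>2 / d\<^sup>2 * (\<epsilon> * (\<epsilon> * \<mu> * (\<epsilon> * \<mu>) - 1))"
      unfolding H0_W uv(1) ip_simps ip_W[OF uv(2,3)] by (simp add: power2_eq_square)
    also have "\<dots> = \<epsilon> * ((\<mu>\<^sup>2 - 1) / \<bar>\<mu>\<^sup>2 - 1\<bar>)"
      unfolding \<sigma>2 d(2) using eps by (auto simp: power2_eq_square)
    also have "(\<mu>\<^sup>2 - 1) / \<bar>\<mu>\<^sup>2 - 1\<bar> = sgn (\<mu>\<^sup>2 - 1)"
      by (simp add: sgn_real_def abs_if divide_eq_eq)
    finally have "ip (H0 p) (H0 p) = \<epsilon> * sgn (\<mu>\<^sup>2 - 1)" .
    moreover have "sgn (\<mu>\<^sup>2 - 1) = 1 \<or> sgn (\<mu>\<^sup>2 - 1) = -1"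
      using mu by (simp add: sgn_real_def)
    ultimately show ?thesis using eps by auto
  qed
  have dir: "\<exists>r>0. H0 p = r *\<^sub>R ?H p" if p: "p \<in> I \<times> J" for p
  proof -
    obtain u v where uv: "p = (u, v)" "u \<in> I" "v \<in> J" using p by auto
    have fk: "f u > 0" "\<bar>\<kappa> v\<bar> > 0" using f_pos uv nz by auto
    have "(2 * f u / (d * \<bar>\<kappa> v\<bar>)) * (- (1 / (2 * f u)) * \<kappa> v) = - \<sigma> / d"
    proof -
      have "\<kappa> v = \<sigma> * \<bar>\<kappa> v\<bar>" using \<sigma>2 by (simp add: \<sigma>[OF uv(3), symmetric] power2_eq_square flip: mult.assoc)
      then have "\<kappa> v / \<bar>\<kappa> v\<bar> = \<sigma>" using fk(2) by (simp add: divide_eq_eq)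
      moreover have "(2 * f u / (d * \<bar>\<kappa> v\<bar>)) * (- (1 / (2 * f u)) * \<kappa> v) = - (\<kappa> v / \<bar>\<kappa> v\<bar>) / d"
        using fk(1) by (simp add: mult_ac)
      ultimately show ?thesis by simp
    qed
    then have "H0 p = (2 * f u / (d * \<bar>\<kappa> v\<bar>)) *\<^sub>R ?H p"
      unfolding H0_W uv(1) mean_curvature_ratio[OF r uv(2,3)] by simp
    then show ?thesis using fk d(1) by (intro exI[of _ "2 * f u / (d * \<bar>\<kappa> v\<bar>)"]) simp
  qed
  have "smooth_on (I \<times> J) H0" "parallel_normal_field (I \<times> J) z H0"
    unfolding H0_def by (rule smooth_on_W parallel_W)+
  then show ?thesis
    unfolding parallel_normalized_mean_curvature_def Let_def using HH unit dir by blast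
qed

text \<open>
  The mean curvature vector is the scalar \<open>- \<kappa> / (2 f)\<close> times a parallel field, so the normal part of its
  derivative in direction \<open>u\<close> is \<open>\<kappa> f' / (2 f\<^sup>2)\<close> times that field.
\<close>

lemma ratio_imp_not_parallel:
  assumes r: "ratio \<mu>"
  shows "\<not> parallel_mean_curvature (I \<times> J) z"
proof
  assume par: "parallel_mean_curvature (I \<times> J) z"
  obtain u v where uv: "u \<in> I" "v \<in> J" using intervals by (auto simp: open_interval_def)
  let ?X = "W 1 (\<epsilon> * \<mu>)"
  obtain W' where W': "(?X has_derivative W') (at (u, v))" "\<And>a. W' a \<in> tangent_space z (u, v)"
    using derivative_W[OF uv] by blast
  note fu = f_pos[OF uv(1)]
  have "((\<lambda>u. - (1 / (2 * f u))) has_real_derivative deriv f u / (2 * (f u)\<^sup>2)) (at u)"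
    using fu by (auto intro!: derivative_eq_intros derivs_f(1)[OF uv(1)] simp: power2_eq_square)
  moreover have "(\<kappa> has_vector_derivative deriv \<kappa> v) (at v)"
    using smooth_on_has_real_derivative[OF smooth_on_kappa uv(2)]
    by (simp add: has_real_derivative_iff_has_vector_derivative)
  ultimately have "((\<lambda>p. - (1 / (2 * f (fst p))) *\<^sub>R \<kappa> (snd p)) has_derivative
      (\<lambda>a. (fst a * (deriv f u / (2 * (f u)\<^sup>2))) *\<^sub>R \<kappa> v
        + (snd a * - (1 / (2 * f u))) *\<^sub>R deriv \<kappa> v)) (at (u, v))"
    by (rule has_derivative_field)
  from has_derivative_scaleR[OF this W'(1)]
  have X: "((\<lambda>p. (- (1 / (2 * f (fst p))) * \<kappa> (snd p)) *\<^sub>R ?X p) has_derivative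
      (\<lambda>a. (- (1 / (2 * f u)) * \<kappa> v) *\<^sub>R W' a
        + ((fst a * (deriv f u / (2 * (f u)\<^sup>2))) * \<kappa> v
          + (snd a * - (1 / (2 * f u))) * deriv \<kappa> v) *\<^sub>R ?X (u, v))) (at (u, v))"
    by simp
  define c where "c = deriv f u / (2 * (f u)\<^sup>2) * \<kappa> v"
  have D: "D_flat (1, 0) (mean_curvature_vector z) (u, v) =
      (- (1 / (2 * f u)) * \<kappa> v) *\<^sub>R W' (1, 0) + c *\<^sub>R ?X (u, v)"
    using D_flat_cong[OF uv _ X, of "mean_curvature_vector z" "(1, 0)"] mean_curvature_ratio[OF r]
    by (simp add: c_def)
  have N: "c *\<^sub>R ?X (u, v) \<in> normal_space z (u, v)"
    using W_normal[OF uv] by (simp add: normal_iff[OF uv] ip_simps)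
  have T: "b *\<^sub>R t \<in> tangent_space z (u, v)" if t: "t \<in> tangent_space z (u, v)" for b t
  proof -
    obtain c d where "t = c *\<^sub>R zu u v + d *\<^sub>R zv u v" using t tangent_iff[OF uv] by blast
    then show ?thesis
      unfolding tangent_iff[OF uv] by (intro exI[of _ "b * c"] exI[of _ "b * d"]) (simp add: scaleR_add_right)
  qed
  have "normal_connection z (1, 0) (mean_curvature_vector z) (u, v) = c *\<^sub>R ?X (u, v)"
    unfolding normal_connection_def D
    by (rule normal_part_eqI[OF uv N]) (use T[OF W'(2)] in \<open>simp only: add_diff_cancel_right'\<close>)
  then have "c *\<^sub>R ?X (u, v) = 0"
    using par uv by (simp add: parallel_mean_curvature_def parallel_normal_field_def)
  moreover have "c \<noteq> 0" using r uv fu f'_nonzero[OF uv(1)] by (simp add: c_def ratio_def)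
  moreover have "?X (u, v) \<noteq> 0"
  proof
    assume "?X (u, v) = 0"
    then have "ip (?X (u, v)) (W 1 0 (u, v)) = 0" by (simp add: ip_simps)
    then show False by (simp add: ip_W[OF uv])
  qed
  ultimately show False by simp
qed

section \<open>The meridian curve\<close>

lemma constant_on_I:
  assumes "\<And>u. u \<in> I \<Longrightarrow> (h has_real_derivative 0) (at u)"
  shows "\<exists>c. \<forall>u\<in>I. h u = c"
proof -
  have "convex I" using intervals by (simp add: open_interval_def is_interval_convex)
  then show ?thesis
    using has_field_derivative_zero_constant[of I h] assms DERIV_subset[of h 0 _ UNIV I] by auto
qed

lemma derivative_eq_on_I:
  assumes "\<And>u. u \<in> I \<Longrightarrow> h u = k u" "u \<in> I"
    and "(h has_real_derivative a) (at u)" "(k has_real_derivative b) (at u)"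
  shows "a = b"
  using DERIV_unique[OF assms(3) has_field_derivative_transform_within_open[OF assms(4)
        open_intervals(1) assms(2)]] assms(1) by metis

lemma derivative_ff':
  assumes "u \<in> I"
  shows "((\<lambda>u. f u * deriv f u) has_real_derivative M u * deriv f u) (at u)"
  using f'_nonzero[OF assms]
  by (auto intro!: derivative_eq_intros derivs_f[OF assms] simp: M_def power2_eq_square)

text \<open>
  Since \<open>(f f')' = M f'\<close>, the function \<open>M\<close> is the constant \<open>c\<close> if and only if \<open>f f' - c f\<close> is constant.
\<close>

lemma M_constant_iff:
  "(\<forall>u\<in>I. M u = c) \<longleftrightarrow> (\<exists>b. \<forall>u\<in>I. deriv f u = (c * f u + b) / f u)"
proof
  assume c: "\<forall>u\<in>I. M u = c"
  have "((\<lambda>u. f u * deriv f u - c * f u) has_real_derivative 0) (at u)" if "u \<in> I" for u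
    using DERIV_diff[OF derivative_ff'[OF that] DERIV_cmult[OF derivs_f(1)[OF that], of c]] c that
    by simp
  from constant_on_I[OF this] obtain b where b: "\<forall>u\<in>I. f u * deriv f u - c * f u = b" by blast
  have "deriv f u = (c * f u + b) / f u" if "u \<in> I" for u
    using b that f_pos[OF that] by (simp add: eq_divide_eq mult.commute) force
  then show "\<exists>b. \<forall>u\<in>I. deriv f u = (c * f u + b) / f u" by blast
next
  assume "\<exists>b. \<forall>u\<in>I. deriv f u = (c * f u + b) / f u"
  then obtain b where b: "\<And>u. u \<in> I \<Longrightarrow> deriv f u = (c * f u + b) / f u" by blast
  show "\<forall>u\<in>I. M u = c"
  proof
    fix u assume u: "u \<in> I"
    have "M u * deriv f u = c * deriv f u"
    proof (rule derivative_eq_on_I[OF _ u derivative_ff'[OF u]])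
      show "f u * deriv f u = c * f u + b" if "u \<in> I" for u
        using b[OF that] f_pos[OF that] by simp
      show "((\<lambda>u. c * f u + b) has_real_derivative c * deriv f u) (at u)"
        by (auto intro!: derivative_eq_intros derivs_f(1)[OF u])
    qed
    then show "M u = c" using f'_nonzero[OF u] by simp
  qed
qed

text \<open>
  If \<open>f f'\<close> is a constant \<open>d\<close>, then \<open>f\<^sup>2\<close> has the derivative \<open>2 d\<close>, and \<open>g' = \<epsilon> f / (2 d)\<close> integrates to the
  power \<open>3/2\<close>.
\<close>

lemma M_zero_iff:
  "(\<forall>u\<in>I. M u = 0) \<longleftrightarrow>
    (\<exists>a b c. a \<noteq> 0 \<and> (\<forall>u\<in>I. f u = sqrt (a * u + b) \<and>
       g u = 2 * \<epsilon> / (3 * a\<^sup>2) * (a * u + b) powr (3 / 2) + c))"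
proof
  assume "\<forall>u\<in>I. M u = 0"
  then obtain d where d: "\<And>u. u \<in> I \<Longrightarrow> deriv f u = d / f u" using M_constant_iff[of 0] by auto
  define a where "a = 2 * d"
  obtain u0 where "u0 \<in> I" using intervals by (auto simp: open_interval_def)
  then have a: "a \<noteq> 0" using d f'_nonzero by (auto simp: a_def)
  have "((\<lambda>u. (f u)\<^sup>2 - a * u) has_real_derivative 0) (at u)" if "u \<in> I" for u
    using d[OF that] f_pos[OF that]
    by (auto intro!: derivative_eq_intros derivs_f(1)[OF that] simp: a_def)
  from constant_on_I[OF this] obtain b where b: "\<forall>u\<in>I. (f u)\<^sup>2 - a * u = b" by blast
  have f2: "a * u + b = (f u)\<^sup>2" if "u \<in> I" for u using b that by force
  have fs: "f u = sqrt (a * u + b)" if "u \<in> I" for u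
    using f2[OF that] f_pos[OF that] by simp
  have "((\<lambda>u. g u - 2 * \<epsilon> / (3 * a\<^sup>2) * (a * u + b) powr (3 / 2)) has_real_derivative 0) (at u)"
    if "u \<in> I" for u
  proof -
    have pos: "a * u + b > 0" using f2[OF that] f_pos[OF that] by simp
    have "((\<lambda>u. a * u + b) has_real_derivative a) (at u)"
      by (auto intro!: derivative_eq_intros)
    from DERIV_chain2[OF has_real_derivative_powr[OF pos, of "3/2"] this]
    have "((\<lambda>u. (a * u + b) powr (3 / 2)) has_real_derivative 3 / 2 * f u * a) (at u)"
      using pos by (simp add: powr_half_sqrt fs[OF that])
    from DERIV_diff[OF derivs_f(3)[OF that] DERIV_cmult[OF this, of "2 * \<epsilon> / (3 * a\<^sup>2)"]]
    have "((\<lambda>u. g u - 2 * \<epsilon> / (3 * a\<^sup>2) * (a * u + b) powr (3 / 2)) has_real_derivative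
      \<epsilon> / (2 * deriv f u) - 2 * \<epsilon> / (3 * a\<^sup>2) * (3 / 2 * f u * a)) (at u)" .
    moreover have "\<epsilon> / (2 * deriv f u) = 2 * \<epsilon> / (3 * a\<^sup>2) * (3 / 2 * f u * a)"
      using a f_pos[OF that] by (simp add: d[OF that] a_def power2_eq_square)
    ultimately show ?thesis by simp
  qed
  from constant_on_I[OF this] obtain c
    where c: "\<forall>u\<in>I. g u - 2 * \<epsilon> / (3 * a\<^sup>2) * (a * u + b) powr (3 / 2) = c" by blast
  have "f u = sqrt (a * u + b) \<and> g u = 2 * \<epsilon> / (3 * a\<^sup>2) * (a * u + b) powr (3 / 2) + c" if "u \<in> I" for u
    using fs[OF that] c that by force
  with a show "\<exists>a b c. a \<noteq> 0 \<and> (\<forall>u\<in>I. f u = sqrt (a * u + b) \<and>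
       g u = 2 * \<epsilon> / (3 * a\<^sup>2) * (a * u + b) powr (3 / 2) + c)" by blast
next
  assume "\<exists>a b c. a \<noteq> 0 \<and> (\<forall>u\<in>I. f u = sqrt (a * u + b) \<and>
       g u = 2 * \<epsilon> / (3 * a\<^sup>2) * (a * u + b) powr (3 / 2) + c)"
  then obtain a b where ab: "\<And>u. u \<in> I \<Longrightarrow> f u = sqrt (a * u + b)" by blast
  have "deriv f u = (0 * f u + a / 2) / f u" if u: "u \<in> I" for u
  proof -
    have "2 * f u * deriv f u = a"
    proof (rule derivative_eq_on_I[OF _ u])
      show "(f u)\<^sup>2 = a * u + b" if "u \<in> I" for u
        using ab[OF that] f_pos[OF that] by simp
      show "((\<lambda>u. (f u)\<^sup>2) has_real_derivative 2 * f u * deriv f u) (at u)"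
        by (auto intro!: derivative_eq_intros derivs_f(1)[OF u])
      show "((\<lambda>u. a * u + b) has_real_derivative a) (at u)"
        by (auto intro!: derivative_eq_intros)
    qed
    then show ?thesis using f_pos[OF u] by (simp add: field_simps)
  qed
  then show "\<forall>u\<in>I. M u = 0" using M_constant_iff[of 0] by blast
qed

text \<open>
  Separation of variables in \<open>M u = \<mu> * \<kappa> v\<close>: for \<open>\<mu> \<noteq> 0\<close> both sides are constant.
\<close>

lemma ratio_iff:
  "(\<exists>\<mu>. ratio \<mu>) \<longleftrightarrow> (\<forall>v\<in>J. \<kappa> v \<noteq> 0) \<and> (\<forall>u\<in>I. M u = 0) \<or>
    (\<exists>k. k \<noteq> 0 \<and> (\<forall>v\<in>J. \<kappa> v = k) \<and> (\<exists>c. c \<noteq> 0 \<and> c\<^sup>2 \<noteq> k\<^sup>2 \<and> (\<forall>u\<in>I. M u = c)))"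
    (is "?L \<longleftrightarrow> ?A \<or> ?B")
proof
  assume ?L
  then obtain \<mu> where r: "ratio \<mu>" by blast
  obtain u0 v0 where uv0: "u0 \<in> I" "v0 \<in> J" using intervals by (auto simp: open_interval_def)
  show "?A \<or> ?B"
  proof (cases "\<mu> = 0")
    case True
    then show ?thesis using r uv0 by (auto simp: ratio_def)
  next
    case False
    have "\<kappa> v = \<kappa> v0" if "v \<in> J" for v
    proof -
      have "\<mu> * \<kappa> v = \<mu> * \<kappa> v0" using r uv0 that unfolding ratio_def by metis
      then show ?thesis using False by simp
    qed
    then have "\<forall>v\<in>J. \<kappa> v = \<kappa> v0" by blast
    moreover have "\<forall>u\<in>I. M u = \<mu> * \<kappa> v0" "\<kappa> v0 \<noteq> 0" "(\<mu> * \<kappa> v0)\<^sup>2 \<noteq> (\<kappa> v0)\<^sup>2"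
      using r uv0 by (auto simp: ratio_def power_mult_distrib)
    ultimately show ?thesis using False by (metis mult_eq_0_iff)
  qed
next
  assume "?A \<or> ?B"
  then show ?L
  proof
    assume ?A
    then have "ratio 0" by (auto simp: ratio_def)
    then show ?L by blast
  next
    assume ?B
    then obtain k c where kc: "k \<noteq> 0" "\<forall>v\<in>J. \<kappa> v = k" "c\<^sup>2 \<noteq> k\<^sup>2" "\<forall>u\<in>I. M u = c" by blast
    then have "ratio (c / k)" by (simp add: ratio_def power_divide)
    then show ?L by blast
  qed
qed

end

theorem theorem6:
  fixes e :: "4 \<Rightarrow> real^4"
    and I J :: "real set"
    and f g \<phi> :: "real \<Rightarrow> real"
    and \<epsilon> :: real
  assumes basis: "pseudo_orthonormal e"
    and intervals: "open_interval I" "open_interval J"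
    and smooth: "smooth_on I f" "smooth_on I g" "smooth_on J \<phi>"
    and f_pos: "\<forall>u\<in>I. f u > 0"
    and lorentz:
      "(\<epsilon> = 1 \<and> (\<forall>v\<in>J. (deriv \<phi> v)\<^sup>2 - (\<phi> v)\<^sup>2 > 0) \<and> (\<forall>u\<in>I. deriv f u * deriv g u > 0)) \<or>
       (\<epsilon> = -1 \<and> (\<forall>v\<in>J. (deriv \<phi> v)\<^sup>2 - (\<phi> v)\<^sup>2 < 0) \<and> (\<forall>u\<in>I. deriv f u * deriv g u < 0))"
    and normalization: "\<forall>u\<in>I. 2 * \<epsilon> * deriv f u * deriv g u = 1"
    and curvature_not_identically_zero: "\<exists>v\<in>J. curvature_c \<epsilon> \<phi> v \<noteq> 0"
  shows
    "(parallel_normalized_mean_curvature (I \<times> J) (meridian_surface e f g \<phi>) \<and>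
      \<not> parallel_mean_curvature (I \<times> J) (meridian_surface e f g \<phi>))
     \<longleftrightarrow>
     (((\<forall>v\<in>J. curvature_c \<epsilon> \<phi> v \<noteq> 0) \<and>
      (\<exists>a b c. a \<noteq> 0 \<and>
         (\<forall>u\<in>I. f u = sqrt (a * u + b) \<and>
                g u = 2 * \<epsilon> / (3 * a\<^sup>2) * (a * u + b) powr (3 / 2) + c)))
     \<or>
     (\<exists>k. k \<noteq> 0 \<and> (\<forall>v\<in>J. curvature_c \<epsilon> \<phi> v = k) \<and>
      (\<exists>b c. c \<noteq> 0 \<and> c\<^sup>2 \<noteq> k\<^sup>2 \<and>
         (\<forall>u\<in>I. deriv f u = (c * f u + b) / f u \<and>
                deriv g u = \<epsilon> / (2 * deriv f u)))))"
proof -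
  interpret meridian e I J f g \<phi> \<epsilon>
    by unfold_locales (use assms in auto)
  have M: "(\<forall>u\<in>I. M u = c) \<longleftrightarrow> (\<exists>b. \<forall>u\<in>I. deriv f u = (c * f u + b) / f u \<and>
      deriv g u = \<epsilon> / (2 * deriv f u))" for c
    unfolding M_constant_iff by (simp add: g')
  have "parallel_normalized_mean_curvature (I \<times> J) z \<and> \<not> parallel_mean_curvature (I \<times> J) z
      \<longleftrightarrow> (\<exists>\<mu>. ratio \<mu>)"
    using parallel_normalized_imp_ratio curvature_not_identically_zero
      ratio_imp_parallel_normalized ratio_imp_not_parallel by blast
  then show ?thesis
    unfolding ratio_iff M_zero_iff M by blast
qed

end
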